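(* If $p=2\pi+1$ where $\pi$ is a prime (and $p$ is prime), then $\mathscr{A}(p)=\mathscr{B}(p)$.
   Context: Let $p$ be a prime. For an integer $r\ge 2$ let $x_1,\ldots,x_r$ be independent indeterminates over $\mathbb{F}_p$ and $f(x)=(x-x_1)\cdots(x-x_r)\in\mathbb{F}_p[x_1,\ldots,x_r][x]$. For integers $e\ge 0$ and $0\le d\le p$ write $f(x)^e=\sum_{i\ge0}c_ix^i$ (with $c_i=0$ for $i<0$) and let $M_d(f(x)^e)$ be the $d\times d$ matrix whose $(i,j)$ entry is $c_{ip+j-d-1}$. Put $\delta(x_1,\ldots,x_r)=\prod_{1\le i<j\le r}(x_i-x_j)$. $\mathscr{A}(p)$ is the set of integer triples $(r,e,d)$ with $r\ge2$, $e\ge1$, $1\le d\le p$, such that $\det M_d(f(x)^e)=\varepsilon\,\delta(x_1,\ldots,x_r)^g$ for some $\varepsilon\in\mathbb{F}_p^{\times}$ and some positive integer $g$. $\mathscr{B}(p)=\mathscr{B}_+(p)\cup\mathscr{B}_0(p)\cup\mathscr{B}_-(p)$ where $\mathscr{B}_+(p)=\{(r,e,d): 2\le r\le p,\ e=p-1,\ d=r\}$, $\mathscr{B}_0(p)=\{(r,e,d): 2\le r\le p+1,\ (p-1)/2<e\le p-1,\ r(p-1-e)\le p-1,\ d=r-1\}$, $\mathscr{B}_-(p)=\{(r,e,d): r\ge2,\ (p-1)/2<e\le p-1,\ r(p-1-e)=p-1,\ d=r-2\}$ (integer triples). *)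

theory Defs
  imports "HOL-Library.Poly_Mapping" "Jordan_Normal_Form.Determinant"
    "Berlekamp_Zassenhaus.Finite_Field"
begin

type_synonym 'a mpoly = "(nat \<Rightarrow>\<^sub>0 nat) \<Rightarrow>\<^sub>0 'a"

definition mVar :: "nat \<Rightarrow> 'a::comm_ring_1 mpoly" where
  "mVar i = Poly_Mapping.single (Poly_Mapping.single i 1) 1"

definition mConst :: "'a::comm_ring_1 \<Rightarrow> 'a mpoly" where
  "mConst c = Poly_Mapping.single 0 c"

text \<open>f(x) = (x - x_1)...(x - x_r); the indeterminate x_k is represented by mVar (k-1).\<close>
definition fpoly :: "nat \<Rightarrow> 'a::comm_ring_1 mpoly poly" where
  "fpoly r = (\<Prod>k<r. [:- mVar k, 1:])"

definition cf :: "nat \<Rightarrow> nat \<Rightarrow> int \<Rightarrow> 'a::comm_ring_1 mpoly" where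
  "cf r e i = (if i < 0 then 0 else Polynomial.coeff (fpoly r ^ e) (nat i))"

text \<open>M_d(f(x)^e): d x d matrix with (i,j) entry c_{ip+j-d-1}, 1 \<le> i,j \<le> d
  (JNF matrices are 0-indexed, hence the shift by one).\<close>
definition Mmat :: "nat \<Rightarrow> nat \<Rightarrow> nat \<Rightarrow> nat \<Rightarrow> 'a::comm_ring_1 mpoly mat" where
  "Mmat p r e d = mat d d (\<lambda>(i, j).
      cf r e (int (i + 1) * int p + int (j + 1) - int d - 1))"

definition vdelta :: "nat \<Rightarrow> 'a::comm_ring_1 mpoly" where
  "vdelta r = (\<Prod>(i, j) \<in> {(i, j). i < j \<and> j < r}. mVar i - mVar j)"

definition setA :: "'p::prime_card itself \<Rightarrow> (int \<times> int \<times> int) set" where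
  "setA _ = {(r, e, d). r \<ge> 2 \<and> e \<ge> 1 \<and> 1 \<le> d \<and> d \<le> int CARD('p) \<and>
      (\<exists>(\<epsilon>::'p mod_ring) (g::nat). \<epsilon> \<noteq> 0 \<and> g > 0 \<and>
         det (Mmat CARD('p) (nat r) (nat e) (nat d)) = mConst \<epsilon> * vdelta (nat r) ^ g)}"

definition setB_plus :: "int \<Rightarrow> (int \<times> int \<times> int) set" where
  "setB_plus p = {(r, e, d). 2 \<le> r \<and> r \<le> p \<and> e = p - 1 \<and> d = r}"

text \<open>The condition (p-1)/2 < e is written as p - 1 < 2e (rational comparison).\<close>
definition setB_zero :: "int \<Rightarrow> (int \<times> int \<times> int) set" where
  "setB_zero p = {(r, e, d). 2 \<le> r \<and> r \<le> p + 1 \<and> p - 1 < 2 * e \<and> e \<le> p - 1 \<and>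
      r * (p - 1 - e) \<le> p - 1 \<and> d = r - 1}"

definition setB_minus :: "int \<Rightarrow> (int \<times> int \<times> int) set" where
  "setB_minus p = {(r, e, d). 2 \<le> r \<and> p - 1 < 2 * e \<and> e \<le> p - 1 \<and>
      r * (p - 1 - e) = p - 1 \<and> d = r - 2}"

definition setB :: "int \<Rightarrow> (int \<times> int \<times> int) set" where
  "setB p = setB_plus p \<union> setB_zero p \<union> setB_minus p"

end

theory Submission
  imports "HOL-Algebra.Algebraic_Closure_Type" Defs
begin

text \<open>
  For $\mathscr{B}(p) \subseteq \mathscr{A}(p)$: adding to the first row $x_i^{p(k-1)}$ times the
  $k$-th row evaluates a Cartier operator at $x_i^p$. As $f^e$ contains $(x-x_i)^e (x-x_j)^e$ and
  $(x-x_i)^p = x^p - x_i^p$, the new row is divisible by $(x_i-x_j)^{2e-p+1}$. Hence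
  $\delta^{2e-p+1}$ divides the determinant, both have the same degree, and the determinant is
  nonzero because for $f = x^r - 1$ (for $f = x^p - x$ if $r = p$) the matrix has exactly one
  nonzero entry in each row and column.

  For $\mathscr{A}(p) \subseteq \mathscr{B}(p)$: the determinant vanishes exactly at the inseparable
  $f$. Comparing total degrees and degrees in $x_1$ gives an equation for $g$ and
  $d(p-1) \le re \le (d+1)(p-1)$, which settles $d \ge r - 1$. If $d \le r-2$, the rows for the
  separable $f = x^r - 1$ can only be nonzero if multiplication by $p$ permutes the residues
  $1, \ldots, d$ modulo $r$, which forces $r \mid p - 1 = 2\pi$, so $r = \pi$ or $r = 2\pi$. The rows
  for $f = x^r - x$ then leave only the triples in $\mathscr{B}_-(p)$ and $(5, 5, 2)$ for $p = 11$.
\<close>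

section \<open>Determinants of coefficient matrices\<close>

text \<open>Row i of the matrix lists the d coefficients of f^e just below x^(ip). For a triple of
  A(p), every separable monic f over the algebraic closure must have a nonzero coefficient in each
  of these windows. For x^r - 1 and x^r - x the exponents that occur form an arithmetic progression,
  so the condition is one on integers. Once r divides p - 1, x^r - 1 says nothing more, because p is
  1 modulo r and every residue is fixed; this is why x^r - x is needed as well. The form of p limits
  r: the divisors of p - 1 above 2 are among pi and 2 pi. The triple (5, 5, 2) for p = 11 passes all
  these tests and is excluded from the other side, by an inseparable f with nonzero determinant. In
  the converse direction r = p needs its own f, because x^p - 1 = (x - 1)^p.\<close>

definition coeff_mat :: "nat \<Rightarrow> 'a::comm_ring_1 poly \<Rightarrow> nat \<Rightarrow> 'a mat" where
  "coeff_mat p F d = mat d d (\<lambda>(i, j). Polynomial.coeff F ((i + 1) * p + j - d))"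

definition root_poly :: "nat \<Rightarrow> (nat \<Rightarrow> 'a::comm_ring_1) \<Rightarrow> 'a poly" where
  "root_poly r v = (\<Prod>k<r. [:- v k, 1:])"

definition vandermonde_prod :: "nat \<Rightarrow> (nat \<Rightarrow> 'a::comm_ring_1) \<Rightarrow> 'a" where
  "vandermonde_prod r v = (\<Prod>(i, j) \<in> {(i, j). i < j \<and> j < r}. v i - v j)"

lemma coeff_mat_carrier [simp]: "coeff_mat p F d \<in> carrier_mat d d"
  by (simp add: coeff_mat_def)

lemma coeff_mat_index [simp]:
  "i < d \<Longrightarrow> j < d \<Longrightarrow> coeff_mat p F d $$ (i, j) = Polynomial.coeff F (p + i * p + j - d)"
  by (simp add: coeff_mat_def)

text \<open>\<open>coeff_mat\<close> accepts any polynomial over any commutative ring, so the roots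
  can be specialized. With 0-based i and j the index is (i+1)p + j - d; for d <= p the subtraction
  on naturals does not truncate.\<close>

lemma Mmat_eq_coeff_mat:
  assumes "d \<le> p"
  shows "Mmat p r e d = coeff_mat p (root_poly r mVar ^ e) d"
proof (rule eq_matI)
  fix i j assume "i < dim_row (coeff_mat p (root_poly r (mVar :: nat \<Rightarrow> 'a mpoly) ^ e) d)"
    and "j < dim_col (coeff_mat p (root_poly r (mVar :: nat \<Rightarrow> 'a mpoly) ^ e) d)"
  then have ij: "i < d" "j < d" by (simp_all add: coeff_mat_def)
  have le: "d \<le> p + i * p + j" using assms by (simp add: trans_le_add1)
  have "int (i + 1) * int p + int (j + 1) - int d - 1 = int (p + i * p + j) - int d"
    by (simp add: algebra_simps)
  also have "\<dots> = int (p + i * p + j - d)" using le by linarith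
  finally show "Mmat p r e d $$ (i, j)
      = coeff_mat p (root_poly r (mVar :: nat \<Rightarrow> 'a mpoly) ^ e) d $$ (i, j)"
    using ij by (simp add: Mmat_def cf_def fpoly_def root_poly_def)
qed (simp_all add: Mmat_def coeff_mat_def)

lemma vdelta_eq: "vdelta r = vandermonde_prod r mVar"
  by (simp add: vdelta_def vandermonde_prod_def)

lemma finite_index_pairs [simp]: "finite {(i::nat, j). i < j \<and> j < r}"
  by (rule finite_subset[of _ "{..<r} \<times> {..<r}"]) auto

lemma card_index_pairs: "2 * card {(i::nat, j). i < j \<and> j < r} = r * (r - 1)"
proof (induction r)
  case 0
  have "{(i::nat, j). i < j \<and> j < 0} = {}" by auto
  then show ?case by (simp only: card.empty)
next
  case (Suc r)
  let ?c = "card {(i::nat, j). i < j \<and> j < r}"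
  have "{(i::nat, j). i < j \<and> j < Suc r} = {(i, j). i < j \<and> j < r} \<union> (\<lambda>i. (i, r)) ` {..<r}"
    by (auto simp: less_Suc_eq)
  moreover have "card \<dots> = ?c + r"
    by (subst card_Un_disjoint) (auto simp: card_image inj_on_def)
  moreover have "2 * (c + r) = Suc r * (Suc r - 1)" if "2 * c = r * (r - 1)" for c
    using that by (cases r) (auto simp: algebra_simps)
  from this[OF Suc.IH] have "2 * (?c + r) = Suc r * (Suc r - 1)" .
  ultimately show ?case by (simp only:)
qed

text \<open>In the Leibniz sum every permutation other than \<pi> meets a zero entry, so a single
  signed product of nonzero entries survives.\<close>

lemma det_monomial_pattern:
  fixes A :: "'a::idom mat"
  assumes A: "A \<in> carrier_mat n n" and \<pi>: "\<pi> permutes {0..<n}"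
    and nz: "\<And>i j. i < n \<Longrightarrow> j < n \<Longrightarrow> A $$ (i, j) \<noteq> 0 \<longleftrightarrow> j = \<pi> i"
  shows "det A \<noteq> 0"
proof -
  have zero: "signof \<sigma> * (\<Prod>i = 0..<n. A $$ (i, \<sigma> i)) = 0"
    if \<sigma>: "\<sigma> permutes {0..<n}" "\<sigma> \<noteq> \<pi>" for \<sigma>
  proof -
    obtain i where i: "\<sigma> i \<noteq> \<pi> i" using \<sigma>(2) by blast
    with \<sigma>(1) \<pi> have "i < n" by (metis atLeastLessThan_iff permutes_not_in zero_le)
    moreover from this have "\<sigma> i < n" using permutes_in_image[OF \<sigma>(1), of i] by simp
    ultimately have "A $$ (i, \<sigma> i) = 0" using nz i by blast
    with \<open>i < n\<close> show ?thesis by (intro mult_zero_right[THEN subst, where P="\<lambda>x. _ * _ = x"])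
      (auto intro!: prod_zero)
  qed
  have "det A = (\<Sum>\<sigma>\<in>{\<sigma>. \<sigma> permutes {0..<n}}.
      if \<sigma> = \<pi> then signof \<pi> * (\<Prod>i = 0..<n. A $$ (i, \<pi> i)) else 0)"
    unfolding det_def'[OF A] by (intro sum.cong) (auto simp: zero)
  also have "\<dots> = signof \<pi> * (\<Prod>i = 0..<n. A $$ (i, \<pi> i))"
    using \<pi> by (simp add: finite_permutations)
  also have "\<dots> \<noteq> 0"
  proof -
    have "A $$ (i, \<pi> i) \<noteq> 0" if "i < n" for i
      using nz[of i "\<pi> i"] permutes_in_image[OF \<pi>, of i] that by simp
    then show ?thesis by (simp add: sign_def)
  qed
  finally show ?thesis .
qed

text \<open>The weights are pulled out of each Leibniz term. Leaving them as factors on both sides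
  avoids dividing by elements that need not be units.\<close>

lemma det_scale_rows_cols:
  fixes A B :: "'a::comm_ring_1 mat"
  assumes A: "A \<in> carrier_mat n n" and B: "B \<in> carrier_mat n n"
    and AB: "\<And>i j. i < n \<Longrightarrow> j < n \<Longrightarrow> u i * w j * A $$ (i, j) = c * B $$ (i, j)"
  shows "(\<Prod>i = 0..<n. u i) * (\<Prod>i = 0..<n. w i) * det A = c ^ n * det B"
proof -
  have "(\<Prod>i = 0..<n. u i) * (\<Prod>i = 0..<n. w i) * (signof \<sigma> * (\<Prod>i = 0..<n. A $$ (i, \<sigma> i)))
      = c ^ n * (signof \<sigma> * (\<Prod>i = 0..<n. B $$ (i, \<sigma> i)))"
    if \<sigma>: "\<sigma> permutes {0..<n}" for \<sigma>
  proof -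
    have "(\<Prod>i = 0..<n. w i) = (\<Prod>i = 0..<n. w (\<sigma> i))"
      using prod.permute[OF \<sigma>, of w] by (simp add: comp_def)
    moreover have "(\<Prod>i = 0..<n. u i) * (\<Prod>i = 0..<n. w (\<sigma> i)) * (\<Prod>i = 0..<n. A $$ (i, \<sigma> i))
       = (\<Prod>i = 0..<n. c * B $$ (i, \<sigma> i))"
      using AB permutes_in_image[OF \<sigma>]
      by (auto simp: prod.distrib[symmetric] intro!: prod.cong)
    ultimately show ?thesis by (simp add: prod.distrib mult_ac)
  qed
  then show ?thesis unfolding det_def'[OF A] det_def'[OF B] sum_distrib_left
    by (intro sum.cong) auto
qed

lemma dvd_det_of_dvd_row:
  fixes A :: "'a::comm_ring_1 mat"
  assumes A: "A \<in> carrier_mat n n" and k: "k < n" and "\<And>j. j < n \<Longrightarrow> c dvd A $$ (k, j)"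
  shows "c dvd det A"
  unfolding det_def'[OF A]
proof (intro dvd_sum dvd_mult)
  fix \<sigma> assume "\<sigma> \<in> {\<sigma>. \<sigma> permutes {0..<n}}"
  then have "\<sigma> permutes {0..<n}" by simp
  from permutes_in_image[OF this, of k] have "\<sigma> k < n" using k by simp
  then have "c dvd A $$ (k, \<sigma> k)" using assms by blast
  moreover have "A $$ (k, \<sigma> k) dvd (\<Prod>i = 0..<n. A $$ (i, \<sigma> i))"
    using k by (intro dvd_prodI) auto
  ultimately show "c dvd (\<Prod>i = 0..<n. A $$ (i, \<sigma> i))" by (rule dvd_trans)
qed

lemma exists_nonzero_in_row:
  fixes A :: "'a::comm_ring_1 mat"
  assumes "A \<in> carrier_mat n n" "det A \<noteq> 0" "k < n"
  shows "\<exists>j<n. A $$ (k, j) \<noteq> 0"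
  using dvd_det_of_dvd_row[of A n k 0] assms by auto

lemma (in comm_ring_hom) det_coeff_mat_hom:
  "det (coeff_mat p (map_poly hom F) d) = hom (det (coeff_mat p F d))"
proof -
  have "coeff_mat p (map_poly hom F) d = map_mat hom (coeff_mat p F d)"
    by (rule eq_matI) (auto simp: coeff_mat_def)
  then show ?thesis by simp
qed

lemma (in comm_ring_hom) map_root_poly:
  "map_poly hom (root_poly r v ^ e) = root_poly r (\<lambda>k. hom (v k)) ^ e"
proof -
  interpret P: map_poly_comm_ring_hom hom ..
  show ?thesis by (simp add: root_poly_def hom_distribs)
qed

lemma (in comm_ring_hom) vandermonde_prod_hom:
  "hom (vandermonde_prod r v) = vandermonde_prod r (\<lambda>k. hom (v k))"
  by (simp add: vandermonde_prod_def hom_distribs case_prod_beta)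

section \<open>Evaluation of multivariate polynomials\<close>

definition eval_monomial :: "(nat \<Rightarrow> 'b::comm_ring_1) \<Rightarrow> (nat \<Rightarrow>\<^sub>0 nat) \<Rightarrow> 'b" where
  "eval_monomial v m = (\<Prod>k\<in>Poly_Mapping.keys m. v k ^ Poly_Mapping.lookup m k)"

definition eval_mpoly :: "('a::comm_ring_1 \<Rightarrow> 'b::comm_ring_1) \<Rightarrow> (nat \<Rightarrow> 'b) \<Rightarrow> 'a mpoly \<Rightarrow> 'b" where
  "eval_mpoly h v P = (\<Sum>m\<in>Poly_Mapping.keys P. h (Poly_Mapping.lookup P m) * eval_monomial v m)"

lemma mpoly_induct [case_names single add]:
  fixes P :: "'a::comm_ring_1 mpoly"
  assumes single: "\<And>m c. Q (Poly_Mapping.single m c)"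
    and add: "\<And>P R. Q P \<Longrightarrow> Q R \<Longrightarrow> Q (P + R)"
  shows "Q P"
proof (induction P rule: update_induct)
  case const
  show ?case using single[of 0 0] by simp
next
  case (update f a b)
  have "Poly_Mapping.update a b f = f + Poly_Mapping.single a b"
    using update(1) by (intro poly_mapping_eqI)
      (auto simp: lookup_update lookup_add lookup_single in_keys_iff when_def)
  then show ?case using add[OF update(3) single] by simp
qed

lemma eval_monomial_superset:
  "finite S \<Longrightarrow> Poly_Mapping.keys m \<subseteq> S \<Longrightarrow> eval_monomial v m = (\<Prod>k\<in>S. v k ^ Poly_Mapping.lookup m k)"
  unfolding eval_monomial_def by (rule prod.mono_neutral_left) (auto simp: in_keys_iff)

lemma eval_monomial_add: "eval_monomial v (m + n) = eval_monomial v m * eval_monomial v n"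
proof -
  let ?S = "Poly_Mapping.keys m \<union> Poly_Mapping.keys n"
  have "eval_monomial v x = (\<Prod>k\<in>?S. v k ^ Poly_Mapping.lookup x k)" if "x \<in> {m, n, m + n}" for x
    using that keys_add[of m n] by (intro eval_monomial_superset) auto
  then show ?thesis by (simp add: lookup_add power_add prod.distrib)
qed

lemma eval_monomial_0 [simp]: "eval_monomial v 0 = 1"
  by (simp add: eval_monomial_def)

context
  fixes h :: "'a::comm_ring_1 \<Rightarrow> 'b::comm_ring_1" and v :: "nat \<Rightarrow> 'b"
  assumes h: "comm_ring_hom h"
begin

interpretation h: comm_ring_hom h by (fact h)

lemma eval_mpoly_superset:
  "finite S \<Longrightarrow> Poly_Mapping.keys P \<subseteq> S \<Longrightarrow> eval_mpoly h v P = (\<Sum>m\<in>S. h (Poly_Mapping.lookup P m) * eval_monomial v m)"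
  unfolding eval_mpoly_def by (rule sum.mono_neutral_left) (auto simp: in_keys_iff)

lemma eval_mpoly_add: "eval_mpoly h v (P + R) = eval_mpoly h v P + eval_mpoly h v R"
proof -
  let ?S = "Poly_Mapping.keys P \<union> Poly_Mapping.keys R"
  have "eval_mpoly h v x = (\<Sum>m\<in>?S. h (Poly_Mapping.lookup x m) * eval_monomial v m)" if "x \<in> {P, R, P + R}" for x
    using that keys_add[of P R] by (intro eval_mpoly_superset) auto
  then show ?thesis by (simp add: lookup_add h.hom_add distrib_right sum.distrib)
qed

lemma eval_mpoly_single: "eval_mpoly h v (Poly_Mapping.single m c) = h c * eval_monomial v m"
  by (simp add: eval_mpoly_def)

lemma eval_mpoly_mult: "eval_mpoly h v (P * R) = eval_mpoly h v P * eval_mpoly h v R"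
proof (induction P rule: mpoly_induct)
  case P: (single m c)
  show ?case
  proof (induction R rule: mpoly_induct)
    case (single n b)
    show ?case
      by (simp add: mult_single eval_mpoly_single eval_monomial_add h.hom_mult mult_ac)
  qed (simp add: eval_mpoly_add algebra_simps)
qed (simp add: eval_mpoly_add algebra_simps)

lemma eval_mpoly_hom: "comm_ring_hom (eval_mpoly h v)"
proof
  show "eval_mpoly h v 0 = 0" by (simp add: eval_mpoly_def)
  show "eval_mpoly h v 1 = 1" using eval_mpoly_single[of 0 1] by simp
qed (simp_all add: eval_mpoly_add eval_mpoly_mult)

lemma eval_mpoly_mVar: "eval_mpoly h v (mVar k) = v k"
  by (simp add: mVar_def eval_mpoly_single eval_monomial_def)

lemma eval_mpoly_mConst: "eval_mpoly h v (mConst c) = h c"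
  by (simp add: mConst_def eval_mpoly_single)

lemma eval_det:
  "eval_mpoly h v (det (coeff_mat p (root_poly r mVar ^ e) d)) = det (coeff_mat p (root_poly r v ^ e) d)"
proof -
  interpret E: comm_ring_hom "eval_mpoly h v" by (rule eval_mpoly_hom)
  show ?thesis
    unfolding E.det_coeff_mat_hom[symmetric] E.map_root_poly eval_mpoly_mVar ..
qed

lemma eval_vandermonde_prod: "eval_mpoly h v (vandermonde_prod r mVar) = vandermonde_prod r v"
proof -
  interpret E: comm_ring_hom "eval_mpoly h v" by (rule eval_mpoly_hom)
  show ?thesis by (simp add: E.vandermonde_prod_hom eval_mpoly_mVar)
qed

end

lemma comm_ring_hom_mConst: "comm_ring_hom (mConst :: 'a::comm_ring_1 \<Rightarrow> 'a mpoly)"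
  by unfold_locales (auto simp: mConst_def mult_single single_add)

lemma mVar_power: "mVar k ^ n = Poly_Mapping.single (Poly_Mapping.single k n) 1"
  by (induction n) (simp_all add: mVar_def mult_single single_add[symmetric])

lemma eval_mpoly_mVar_id: "eval_mpoly mConst mVar P = P"
proof (induction P rule: mpoly_induct)
  case (single m c)
  have "mConst c * (\<Prod>k\<in>S. mVar k ^ Poly_Mapping.lookup m k)
      = Poly_Mapping.single (\<Sum>k\<in>S. Poly_Mapping.single k (Poly_Mapping.lookup m k)) c" if "finite S" for S
    using that
  proof (induction S)
    case empty
    show ?case by (simp add: mConst_def)
  next
    case (insert x F)
    then show ?case by (simp add: mVar_power mult.left_commute[of "mConst c"] mult_single)
  qed
  from this[of "Poly_Mapping.keys m"] have *: "mConst c * eval_monomial mVar m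
      = Poly_Mapping.single (\<Sum>k\<in>Poly_Mapping.keys m. Poly_Mapping.single k (Poly_Mapping.lookup m k)) c"
    by (simp add: eval_monomial_def)
  have "(\<Sum>k\<in>Poly_Mapping.keys m. Poly_Mapping.single k (Poly_Mapping.lookup m k)) = m"
    by (rule poly_mapping_eqI)
      (auto simp: lookup_sum lookup_single when_def in_keys_iff sum.delta')
  with * show ?case by (simp add: eval_mpoly_single[OF comm_ring_hom_mConst])
qed (simp add: eval_mpoly_add[OF comm_ring_hom_mConst])

text \<open>Substituting $x_j$ for $x_i$ gives a ring homomorphism that is the identity modulo
  $x_i - x_j$, so its kernel is exactly the ideal of $x_i - x_j$.\<close>

lemma mVar_diff_dvd_subst:
  "mVar i - mVar j dvd P - eval_mpoly mConst (mVar(i := mVar j)) (P :: 'a::comm_ring_1 mpoly)"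
proof -
  let ?E = "eval_mpoly mConst :: (nat \<Rightarrow> 'a mpoly) \<Rightarrow> 'a mpoly \<Rightarrow> 'a mpoly"
  let ?w = "mVar(i := mVar j) :: nat \<Rightarrow> 'a mpoly"
  let ?x = "mVar i - mVar j :: 'a mpoly"
  note hom = comm_ring_hom_mConst
  have pow: "?x dvd mVar k ^ n - ?w k ^ n" for k n
    using power_diff_sumr2[of "mVar i :: 'a mpoly" n "mVar j"] by (cases "k = i") auto
  have "?x dvd (\<Prod>k\<in>S. mVar k ^ n k) - (\<Prod>k\<in>S. ?w k ^ n k)" if "finite S" for S n
    using that
  proof (induction S)
    case (insert k S)
    have "(\<Prod>k\<in>insert k S. mVar k ^ n k) - (\<Prod>k\<in>insert k S. ?w k ^ n k)
      = mVar k ^ n k * ((\<Prod>k\<in>S. mVar k ^ n k) - (\<Prod>k\<in>S. ?w k ^ n k))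
        + (mVar k ^ n k - ?w k ^ n k) * (\<Prod>k\<in>S. ?w k ^ n k)"
      using insert by (simp add: algebra_simps)
    then show ?case using insert pow[of k "n k"] by (simp only:) (intro dvd_add dvd_mult dvd_mult2)
  qed simp
  then have mono: "?x dvd eval_monomial mVar m - eval_monomial ?w m" for m
    by (simp add: eval_monomial_def)
  have "?x dvd ?E mVar P - ?E ?w P"
  proof (induction P rule: mpoly_induct)
    case (single m c)
    show ?case using mono[of m]
      by (simp add: eval_mpoly_single[OF hom] right_diff_distrib[symmetric] del: fun_upd_apply)
  next
    case (add P R)
    have "?E mVar (P + R) - ?E ?w (P + R) = (?E mVar P - ?E ?w P) + (?E mVar R - ?E ?w R)"
      by (simp add: eval_mpoly_add[OF hom])
    then show ?case using add by (simp only: dvd_add)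
  qed
  then show ?thesis by (simp add: eval_mpoly_mVar_id)
qed

lemma mVar_diff_dvd_iff:
  assumes "i \<noteq> j"
  shows "mVar i - mVar j dvd P \<longleftrightarrow> eval_mpoly mConst (mVar(i := mVar j)) (P :: 'a::comm_ring_1 mpoly) = 0"
proof
  interpret E: comm_ring_hom "eval_mpoly mConst (mVar(i := mVar j)) :: 'a mpoly \<Rightarrow> _"
    by (rule eval_mpoly_hom[OF comm_ring_hom_mConst])
  assume "mVar i - mVar j dvd P"
  then obtain Q where "P = (mVar i - mVar j) * Q" by (elim dvdE)
  then show "eval_mpoly mConst (mVar(i := mVar j)) P = 0" using assms
    by (simp add: hom_distribs eval_mpoly_mVar[OF comm_ring_hom_mConst])
qed (use mVar_diff_dvd_subst[of i j P] in simp)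

section \<open>Differences of variables as pairwise non-associated primes\<close>

lemma inj_mVar: "mVar i = (mVar j :: 'a::comm_ring_1 mpoly) \<longleftrightarrow> i = j"
proof
  assume "mVar i = (mVar j :: 'a mpoly)"
  then have "Poly_Mapping.lookup (mVar i :: 'a mpoly) (Poly_Mapping.single j 1) \<noteq> 0"
    by (simp add: mVar_def)
  then have "Poly_Mapping.single i 1 = (Poly_Mapping.single j 1 :: nat \<Rightarrow>\<^sub>0 nat)"
    by (auto simp: mVar_def lookup_single when_def split: if_splits)
  then have "Poly_Mapping.lookup (Poly_Mapping.single i (1::nat)) j \<noteq> 0" by simp
  then show "i = j" by (auto simp: lookup_single when_def split: if_splits)
qed simp

text \<open>Substituting x_j for x_i is a homomorphism into a domain whose kernel is generated by
  x_i - x_j; hence x_i - x_j is prime.\<close>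

lemma mVar_diff_dvd_mult:
  fixes P Q :: "'a::idom mpoly"
  assumes "i \<noteq> j" "mVar i - mVar j dvd P * Q"
  shows "mVar i - mVar j dvd P \<or> mVar i - mVar j dvd Q"
  using assms(2) by (simp add: mVar_diff_dvd_iff[OF assms(1)] eval_mpoly_mult[OF comm_ring_hom_mConst])

text \<open>The substitution can identify x_k with x_l only if {k, l} = {i, j}; ordering both pairs
  increasingly rules out the swapped pair.\<close>

lemma mVar_diff_not_dvd:
  assumes "i < j" "k < l" "(i, j) \<noteq> (k, l)"
  shows "\<not> mVar i - mVar j dvd mVar k - (mVar l :: 'a::comm_ring_1 mpoly)"
proof -
  interpret E: comm_ring_hom "eval_mpoly mConst (mVar(i := mVar j)) :: 'a mpoly \<Rightarrow> _"
    by (rule eval_mpoly_hom[OF comm_ring_hom_mConst])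
  show ?thesis using assms
    by (subst mVar_diff_dvd_iff)
      (auto simp: hom_distribs eval_mpoly_mVar[OF comm_ring_hom_mConst] inj_mVar)
qed

lemma mVar_diff_power_dvd_mult_cancel:
  fixes P Q :: "'a::idom mpoly"
  assumes ij: "i \<noteq> j" and P: "\<not> mVar i - mVar j dvd P" and dvd: "(mVar i - mVar j) ^ n dvd P * Q"
  shows "(mVar i - mVar j) ^ n dvd Q"
  using dvd
proof (induction n arbitrary: Q)
  case (Suc n)
  let ?x = "mVar i - mVar j :: 'a mpoly"
  have "?x dvd P * Q" using Suc.prems by (rule dvd_trans[rotated]) simp
  with P mVar_diff_dvd_mult[OF ij] obtain R where R: "Q = ?x * R" by (blast elim: dvdE)
  moreover have "?x \<noteq> 0" using ij by (simp add: inj_mVar)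
  ultimately have "?x ^ n dvd P * R" using Suc.prems by (simp add: mult.left_commute[of P])
  from Suc.IH[OF this] show ?case by (simp add: R mult_dvd_mono)
qed simp

text \<open>The n-th powers are split off D one pair at a time; this uses that the differences are
  primes not dividing each other, and no unique factorization.\<close>

lemma vandermonde_prod_power_dvd:
  fixes D :: "'a::idom mpoly"
  assumes "\<And>i j. i < j \<Longrightarrow> j < r \<Longrightarrow> (mVar i - mVar j) ^ n dvd D"
  shows "vandermonde_prod r mVar ^ n dvd D"
proof -
  have "(\<Prod>(i, j)\<in>S. mVar i - mVar j) ^ n dvd D"
    if "finite S" "S \<subseteq> {(i, j). i < j \<and> j < r}" for S
    using that
  proof (induction S)
    case (insert x S)
    obtain i j where x: "x = (i, j)" by force
    with insert.prems have ij: "i < j" "j < r" by auto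
    have one: "\<not> mVar i - mVar j dvd (1 :: 'a mpoly)"
    proof -
      interpret E: comm_ring_hom "eval_mpoly mConst (mVar(i := mVar j)) :: 'a mpoly \<Rightarrow> _"
        by (rule eval_mpoly_hom[OF comm_ring_hom_mConst])
      show ?thesis using ij by (subst mVar_diff_dvd_iff) auto
    qed
    let ?V = "(\<Prod>(i, j)\<in>S. mVar i - mVar j) :: 'a mpoly"
    obtain R where R: "D = ?V ^ n * R" using insert by (auto elim: dvdE)
    have "\<not> mVar i - mVar j dvd ?V ^ n"
    proof -
      have "\<exists>(k, l)\<in>T. mVar i - mVar j dvd mVar k - (mVar l :: 'a mpoly)"
        if "mVar i - mVar j dvd ((\<Prod>(k, l)\<in>T. mVar k - mVar l) :: 'a mpoly)" "finite T" for T
        using that(2,1)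
      proof (induction T)
        case (insert y T)
        obtain k l where "y = (k, l)" by force
        then show ?case using insert mVar_diff_dvd_mult[of i j "mVar k - mVar l"] ij by auto
      qed (use one in simp)
      moreover have "\<not> mVar i - mVar j dvd mVar k - (mVar l :: 'a mpoly)" if "(k, l) \<in> S" for k l
        by (rule mVar_diff_not_dvd) (use ij that insert.prems insert.hyps x in auto)
      ultimately have "\<not> mVar i - mVar j dvd ?V" using \<open>finite S\<close> by blast
      then show ?thesis
      proof (induction n)
        case (Suc n)
        then show ?case using mVar_diff_dvd_mult[of i j ?V "?V ^ n"] ij by auto
      qed (use one in simp)
    qed
    then have "(mVar i - mVar j) ^ n dvd R"
      using mVar_diff_power_dvd_mult_cancel[of i j "?V ^ n" n R] assms[OF ij] ij R by simp
    then show ?case using insert.hyps by (simp add: x R power_mult_distrib mult.commute mult_dvd_mono)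
  qed simp
  from this[OF finite_index_pairs subset_refl] show ?thesis by (simp add: vandermonde_prod_def)
qed

section \<open>Divisibility of the determinant by powers of differences\<close>

lemma CHAR_eq_primeI:
  assumes "prime p" "of_nat p = (0 :: 'a::comm_ring_1)"
  shows "CHAR('a) = p"
proof -
  have "CHAR('a) dvd p" using assms(2) by (simp add: of_nat_eq_0_iff_char_dvd)
  then have "CHAR('a) = 1 \<or> CHAR('a) = p" using assms(1) prime_nat_iff by blast
  then show ?thesis using CHAR_not_1[where 'a='a] by auto
qed

lemma linear_power_prime:
  assumes "prime p" "of_nat p = (0 :: 'a::comm_ring_1)"
  shows "[:- a, 1:] ^ p = Polynomial.monom 1 p + [:(- a) ^ p :: 'a:]"
proof -
  have "CHAR('a poly) = p"
    using assms by (intro CHAR_eq_primeI) (simp_all add: of_nat_poly)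
  moreover have "[:- a, 1:] = Polynomial.monom 1 1 + [:- a:]"
    by (simp add: Polynomial.monom_altdef)
  ultimately show ?thesis using assms(1) freshmans_dream[where 'a="'a poly"]
    by (simp add: Polynomial.monom_power poly_const_pow)
qed

text \<open>The Cartier operator $\sum c_n x^n \mapsto \sum c_{ip+p-1} y^i$, evaluated at $y = a^p$. It
  kills the multiples of $(x-a)^p = x^p - a^p$.\<close>

definition cartier_eval :: "nat \<Rightarrow> nat \<Rightarrow> 'a::comm_ring_1 \<Rightarrow> 'a poly \<Rightarrow> 'a" where
  "cartier_eval p d a P = (\<Sum>i<d. a ^ (p * i) * Polynomial.coeff P (i * p + (p - 1)))"

text \<open>Telescoping: with q_i the coefficient of Q at ip + p - 1, the i-th summand is a^(pi)
  q_(i-1) - a^(p(i+1)) q_i. Only -a^(pd) q_(d-1) remains, and the degree bound makes q_(d-1)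
  zero.\<close>

lemma cartier_eval_linear_power:
  fixes a :: "'a::comm_ring_1"
  assumes p: "prime p" "of_nat p = (0 :: 'a)" and odd: "odd p"
    and deg: "Polynomial.degree Q + 1 < d * p"
  shows "cartier_eval p d a ([:- a, 1:] ^ p * Q) = 0"
proof -
  let ?q = "\<lambda>i. Polynomial.coeff Q (i * p + (p - 1))"
  have p0: "p > 0" using p(1) by (rule prime_gt_0_nat)
  have cf: "Polynomial.coeff ([:- a, 1:] ^ p * Q) n
      = (if n \<ge> p then Polynomial.coeff Q (n - p) else 0) - a ^ p * Polynomial.coeff Q n" for n
    using odd by (simp add: linear_power_prime[OF p] distrib_right Polynomial.coeff_monom_mult)
  have "cartier_eval p (Suc n) a ([:- a, 1:] ^ p * Q) = - (a ^ (p * Suc n) * ?q n)" for n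
  proof (induction n)
    case 0
    show ?case using p0 by (simp add: cartier_eval_def cf)
  next
    case (Suc n)
    have ge: "p \<le> Suc n * p + (p - 1)" by simp
    have "Suc n * p + (p - 1) - p = n * p + (p - 1)" by simp
    then have "Polynomial.coeff ([:- a, 1:] ^ p * Q) (Suc n * p + (p - 1)) = ?q n - a ^ p * ?q (Suc n)"
      using ge by (simp only: cf if_True)
    moreover have "cartier_eval p (Suc (Suc n)) a ([:- a, 1:] ^ p * Q)
        = cartier_eval p (Suc n) a ([:- a, 1:] ^ p * Q)
          + a ^ (p * Suc n) * Polynomial.coeff ([:- a, 1:] ^ p * Q) (Suc n * p + (p - 1))"
      by (simp only: cartier_eval_def sum.lessThan_Suc)
    moreover have pw: "a ^ (p * Suc (Suc n)) = a ^ (p * Suc n) * a ^ p"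
      by (simp add: power_add[symmetric] add_ac)
    ultimately have "cartier_eval p (Suc (Suc n)) a ([:- a, 1:] ^ p * Q)
        = - (a ^ (p * Suc n) * ?q n) + a ^ (p * Suc n) * (?q n - a ^ p * ?q (Suc n))"
      unfolding Suc.IH by (simp only:)
    also have "\<dots> = - (a ^ (p * Suc (Suc n)) * ?q (Suc n))"
      unfolding pw by (simp add: right_diff_distrib mult.assoc)
    finally show ?case .
  qed
  moreover obtain n where n: "d = Suc n" using deg by (cases d) auto
  moreover have "?q n = 0" using deg p0 by (intro coeff_eq_0) (simp add: n)
  ultimately show ?thesis by simp
qed

lemma cartier_eval_sum: "cartier_eval p d a (\<Sum>k\<in>S. f k) = (\<Sum>k\<in>S. cartier_eval p d a (f k))"
  unfolding cartier_eval_def Polynomial.coeff_sum sum_distrib_left by (rule sum.swap)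

lemma cartier_eval_smult: "cartier_eval p d a (Polynomial.smult c P) = c * cartier_eval p d a P"
  by (simp add: cartier_eval_def sum_distrib_left mult_ac)

text \<open>Expand $(x-b)^e$ at $a$: a summand either contains $(x-a)^p$, or the factor
  $(a-b)^{2e-p+1}$.\<close>

lemma power_dvd_cartier_eval:
  fixes a b :: "'a::comm_ring_1"
  assumes p: "prime p" "of_nat p = (0 :: 'a)" "odd p" and e: "e \<le> p"
    and deg: "2 * e + Polynomial.degree G + 2 \<le> (d + 1) * p"
  shows "(a - b) ^ (2 * e + 1 - p) dvd cartier_eval p d a ([:- a, 1:] ^ e * [:- b, 1:] ^ e * G)"
proof -
  have "[:- b, 1:] = [:- a, 1:] + [:a - b:]" by simp
  then have "[:- b, 1:] ^ e = (\<Sum>k\<le>e. of_nat (e choose k) * [:- a, 1:] ^ k * [:a - b:] ^ (e - k))"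
    by (simp only: binomial_ring)
  also have "\<dots> = (\<Sum>k\<le>e. Polynomial.smult (of_nat (e choose k) * (a - b) ^ (e - k)) ([:- a, 1:] ^ k))"
    by (intro sum.cong) (simp_all add: poly_const_pow of_nat_poly mult_ac)
  finally have "[:- a, 1:] ^ e * [:- b, 1:] ^ e * G
      = (\<Sum>k\<le>e. Polynomial.smult (of_nat (e choose k) * (a - b) ^ (e - k)) ([:- a, 1:] ^ (e + k) * G))"
    by (simp add: sum_distrib_left sum_distrib_right power_add mult_ac)
  moreover have "(a - b) ^ (2 * e + 1 - p) dvd cartier_eval p d a
      (Polynomial.smult (of_nat (e choose k) * (a - b) ^ (e - k)) ([:- a, 1:] ^ (e + k) * G))"
    if "k \<le> e" for k
  proof (cases "e + k \<ge> p")
    case True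
    let ?Q = "[:- a, 1:] ^ (e + k - p) * G"
    have "Polynomial.degree ?Q \<le> (e + k - p) + Polynomial.degree G"
      by (intro order.trans[OF degree_mult_le] add_mono order.trans[OF degree_power_le]) auto
    moreover have "(e + k - p) + Polynomial.degree G + 1 < d * p" using deg True that by simp
    ultimately have "Polynomial.degree ?Q + 1 < d * p" by linarith
    then have "cartier_eval p d a ([:- a, 1:] ^ p * ?Q) = 0"
      by (intro cartier_eval_linear_power p)
    moreover have "[:- a, 1:] ^ p * ?Q = [:- a, 1:] ^ (e + k) * G"
      using True by (simp add: power_add[symmetric] mult.assoc[symmetric])
    ultimately show ?thesis by (simp add: cartier_eval_smult)
  next
    \<comment> \<open>Here k <= p - 1 - e, so e - k >= 2e + 1 - p.\<close>
    case False
    then show ?thesis unfolding cartier_eval_smult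
      by (intro dvd_mult2 dvd_mult le_imp_power_dvd) simp
  qed
  ultimately show ?thesis by (auto simp: cartier_eval_sum intro!: dvd_sum)
qed

lemma dvd_det_coeff_mat:
  fixes F :: "'a::comm_ring_1 poly"
  assumes d: "1 \<le> d" "d \<le> p"
    and dvd: "\<And>m. m < d \<Longrightarrow> c dvd cartier_eval p d a (Polynomial.monom 1 m * F)"
  shows "c dvd det (coeff_mat p F d)"
proof -
  define W where "W = mat d d (\<lambda>(i, j). if i = 0 then a ^ (p * j) else if i = j then 1 else 0)"
  have W: "W \<in> carrier_mat d d" by (simp add: W_def)
  have "upper_triangular W" by (auto simp: W_def)
  then have "det W = prod_list (diag_mat W)" using W by (rule det_upper_triangular)
  also have "\<dots> = 1"
    by (rule prod_list_neutral) (auto simp: diag_mat_def W_def)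
  finally have "det (W * coeff_mat p F d) = det (coeff_mat p F d)"
    using det_mult[OF W coeff_mat_carrier] by simp
  moreover have "c dvd det (W * coeff_mat p F d)"
  proof (rule dvd_det_of_dvd_row[of _ d 0])
    fix j assume j: "j < d"
    have "(W * coeff_mat p F d) $$ (0, j) = (\<Sum>i<d. a ^ (p * i) * Polynomial.coeff F (p + i * p + j - d))"
      using j by (simp add: W_def coeff_mat_def scalar_prod_def lessThan_atLeast0)
    \<comment> \<open>Multiplying F by x^(d-1-j) moves the index p + ip + j - d to ip + p - 1, the
      one the Cartier operator reads; this is why all x^m F with m < d are considered.\<close>
    also have "\<dots> = cartier_eval p d a (Polynomial.monom 1 (d - 1 - j) * F)"
      unfolding cartier_eval_def
    proof (intro sum.cong refl arg_cong2[where f="(*)"])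
      fix i
      have "d - 1 - j \<le> i * p + (p - 1)" "i * p + (p - 1) - (d - 1 - j) = p + i * p + j - d"
        using d j by auto
      then show "Polynomial.coeff F (p + i * p + j - d)
          = Polynomial.coeff (Polynomial.monom 1 (d - 1 - j) * F) (i * p + (p - 1))"
        by (simp add: Polynomial.coeff_monom_mult)
    qed
    finally show "c dvd (W * coeff_mat p F d) $$ (0, j)" using dvd[of "d - 1 - j"] j by simp
  qed (use d mult_carrier_mat[OF W coeff_mat_carrier] in auto)
  ultimately show ?thesis by simp
qed

lemma degree_root_poly_le: "Polynomial.degree (\<Prod>k\<in>S. [:- v k, 1:] :: 'a::comm_ring_1 poly) \<le> card S"
proof (cases "finite S")
  case True
  then have "Polynomial.degree (\<Prod>k\<in>S. [:- v k, 1:]) \<le> (\<Sum>k\<in>S. Polynomial.degree [:- v k, 1:])"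
    using degree_prod_sum_le[of S "\<lambda>k. [:- v k, 1:]"] by (simp add: comp_def)
  also have "\<dots> \<le> (\<Sum>k\<in>S. 1)" by (intro sum_mono) auto
  finally show ?thesis by simp
qed simp

lemma power_dvd_det_root_poly:
  fixes v :: "nat \<Rightarrow> 'a::comm_ring_1"
  assumes p: "prime p" "of_nat p = (0 :: 'a)" "odd p" and e: "e \<le> p"
    and d: "1 \<le> d" "d \<le> p" and deg: "r * e \<le> (d + 1) * (p - 1)" and ij: "i < j" "j < r"
  shows "(v i - v j) ^ (2 * e + 1 - p) dvd det (coeff_mat p (root_poly r v ^ e) d)"
proof (rule dvd_det_coeff_mat[OF d])
  fix m assume m: "m < d"
  let ?H = "\<Prod>k\<in>{..<r} - {i} - {j}. [:- v k, 1:]"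
  have "root_poly r v = [:- v i, 1:] * ([:- v j, 1:] * ?H)"
    unfolding root_poly_def using ij
    by (subst prod.remove[of _ i], simp, simp, subst prod.remove[of _ j]) auto
  then have F: "Polynomial.monom 1 m * root_poly r v ^ e
      = [:- v i, 1:] ^ e * [:- v j, 1:] ^ e * (Polynomial.monom 1 m * ?H ^ e)"
    by (simp only: power_mult_distrib mult_ac)
  have "Polynomial.degree ?H \<le> r - 2"
    using degree_root_poly_le[of v "{..<r} - {i} - {j}"] ij by simp
  then have "Polynomial.degree (?H ^ e) \<le> (r - 2) * e"
    by (intro order.trans[OF degree_power_le]) simp
  then have "Polynomial.degree (Polynomial.monom 1 m * ?H ^ e) \<le> m + (r - 2) * e"
    by (intro order.trans[OF degree_mult_le] add_mono degree_monom_le)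
  \<comment> \<open>The left side is re + m + 2, and m <= d - 1 together with re <= (d+1)(p-1)
    bounds it by (d+1)(p-1) + d + 1 = (d+1)p.\<close>
  moreover have "2 * e + (m + (r - 2) * e) + 2 \<le> (d + 1) * p"
  proof -
    have "2 + (r - 2) = r" using ij by simp
    then have "2 * e + (r - 2) * e = r * e" by (metis add_mult_distrib)
    moreover have "(d + 1) * (p - 1) + (d + 1) = (d + 1) * p"
      using prime_gt_0_nat[OF p(1)] by (cases p) (simp_all add: algebra_simps)
    ultimately show ?thesis using deg m by linarith
  qed
  ultimately show "(v i - v j) ^ (2 * e + 1 - p) dvd
      cartier_eval p d (v i) (Polynomial.monom 1 m * root_poly r v ^ e)"
    unfolding F by (intro power_dvd_cartier_eval p e) linarith
qed

section \<open>Homogeneity\<close>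

lemma root_poly_Suc: "root_poly (Suc r) v = root_poly r v * [:- v r, 1:]"
  by (simp only: root_poly_def prod.lessThan_Suc)

text \<open>The coefficient of x^n in f^e is homogeneous of degree re - n in the roots; the factor
  s^n on the left avoids this difference. The proof substitutes s x for x.\<close>

lemma coeff_scaled_root_poly:
  fixes s :: "'a::comm_ring_1"
  shows "s ^ n * Polynomial.coeff (root_poly r (\<lambda>k. s * v k) ^ e) n
    = s ^ (r * e) * Polynomial.coeff (root_poly r v ^ e) n"
proof -
  have "root_poly r (\<lambda>k. s * v k) \<circ>\<^sub>p [:0, s:] = Polynomial.smult (s ^ r) (root_poly r v)"
  proof (induction r)
    case (Suc r)
    have "[:- (s * v r), 1:] \<circ>\<^sub>p [:0, s:] = Polynomial.smult s [:- v r, 1:]"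
      by (simp add: pcompose_pCons)
    then show ?case
      by (simp only: root_poly_Suc pcompose_mult Suc.IH mult_smult_left mult_smult_right smult_smult
          power_Suc mult.commute)
  qed (simp add: root_poly_def pcompose_1)
  moreover have "(P ^ e) \<circ>\<^sub>p [:0, s:] = (P \<circ>\<^sub>p [:0, s:]) ^ e" for P
    by (induction e) (simp_all add: pcompose_1 pcompose_mult)
  ultimately have "(root_poly r (\<lambda>k. s * v k) ^ e) \<circ>\<^sub>p [:0, s:]
      = Polynomial.smult (s ^ (r * e)) (root_poly r v ^ e)"
    by (simp add: smult_power power_mult)
  from arg_cong[OF this, of "\<lambda>P. Polynomial.coeff P n"] show ?thesis
    by (simp add: coeff_pcompose_linear)
qed

text \<open>The entry (i, j) has degree re + d - (p + ip) - j in the roots, which splits into a row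
  weight and a column weight. So the determinant is homogeneous, and its degree is the difference of
  the two exponents of s.\<close>

lemma det_scaled_root_poly:
  fixes s :: "'a::comm_ring_1"
  assumes "d \<le> p"
  shows "s ^ ((\<Sum>i = 0..<d. p + i * p) + (\<Sum>i = 0..<d. i))
      * det (coeff_mat p (root_poly r (\<lambda>k. s * v k) ^ e) d)
    = s ^ (d * (r * e + d)) * det (coeff_mat p (root_poly r v ^ e) d)"
proof -
  have "(\<Prod>i = 0..<d. s ^ (p + i * p)) * (\<Prod>i = 0..<d. s ^ i)
      * det (coeff_mat p (root_poly r (\<lambda>k. s * v k) ^ e) d)
    = (s ^ (r * e + d)) ^ d * det (coeff_mat p (root_poly r v ^ e) d)"
  proof (rule det_scale_rows_cols)
    fix i j assume ij: "i < d" "j < d"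
    let ?n = "p + i * p + j - d"
    have "p + i * p + j = ?n + d" using assms by (simp add: trans_le_add1)
    then have "s ^ (p + i * p) * s ^ j = s ^ ?n * s ^ d" by (metis power_add)
    then have "s ^ (p + i * p) * s ^ j * Polynomial.coeff (root_poly r (\<lambda>k. s * v k) ^ e) ?n
        = s ^ d * (s ^ ?n * Polynomial.coeff (root_poly r (\<lambda>k. s * v k) ^ e) ?n)"
      by (simp only: mult_ac)
    also have "\<dots> = s ^ (r * e + d) * Polynomial.coeff (root_poly r v ^ e) ?n"
      unfolding coeff_scaled_root_poly[of s ?n r v e] by (simp only: power_add mult_ac)
    finally show "s ^ (p + i * p) * s ^ j * coeff_mat p (root_poly r (\<lambda>k. s * v k) ^ e) d $$ (i, j)
        = s ^ (r * e + d) * coeff_mat p (root_poly r v ^ e) d $$ (i, j)"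
      using ij by (simp only: coeff_mat_index)
  qed simp_all
  moreover have "(s ^ (r * e + d)) ^ d = s ^ (d * (r * e + d))"
    by (simp only: power_mult[symmetric] mult.commute)
  ultimately show ?thesis by (simp only: power_sum[symmetric] power_add[symmetric])
qed

lemma vandermonde_prod_scaled:
  "vandermonde_prod r (\<lambda>k. s * v k) = s ^ card {(i::nat, j). i < j \<and> j < r} * vandermonde_prod r v"
  unfolding vandermonde_prod_def right_diff_distrib[symmetric] case_prod_beta prod.distrib
  by simp

lemma twice_row_col_weights:
  fixes p d :: nat
  shows "2 * ((\<Sum>i = 0..<d. p + i * p) + (\<Sum>i = 0..<d. i)) = p * d * (d + 1) + d * (d - 1)"
proof (induction d)
  case (Suc d)
  then show ?case by (cases d) (simp_all add: algebra_simps)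
qed simp

text \<open>The hypothesis, doubled and rearranged to avoid halves and differences, says that the
  determinant has the degree of the g-th power of the Vandermonde product.\<close>

lemma weights_eq_of_degree_eq:
  fixes p d r e g :: nat
  assumes "p * d * (d + 1) + d * (d - 1) + g * (r * (r - 1)) = 2 * d * (r * e + d)"
  shows "(\<Sum>i = 0..<d. p + i * p) + (\<Sum>i = 0..<d. i) + g * card {(i::nat, j). i < j \<and> j < r}
    = d * (r * e + d)"
    (is "?A + g * ?C = _")
proof -
  have "2 * (?A + g * ?C) = 2 * ?A + g * (2 * ?C)" by simp
  also have "\<dots> = 2 * d * (r * e + d)"
    unfolding twice_row_col_weights card_index_pairs by (fact assms)
  finally show ?thesis by simp
qed

lemma comm_ring_hom_const_mConst: "comm_ring_hom (\<lambda>c. [:mConst c:] :: 'a::comm_ring_1 mpoly poly)"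
  by unfold_locales (auto simp: mConst_def mult_single single_add mult.commute)

text \<open>Substituting $t x_k$ for $x_k$ separates the homogeneous components.\<close>

lemma lookup_coeff_eval_scaled:
  fixes P :: "'a::comm_ring_1 mpoly"
  shows "Poly_Mapping.lookup (Polynomial.coeff
      (eval_mpoly (\<lambda>c. [:mConst c:]) (\<lambda>k. [:0, 1:] * [:mVar k:]) P) n) m
    = (if n = (\<Sum>k\<in>Poly_Mapping.keys m. Poly_Mapping.lookup m k) then Poly_Mapping.lookup P m else 0)"
proof (induction P rule: mpoly_induct)
  case (single l c)
  note hom = comm_ring_hom_const_mConst
  interpret L: comm_ring_hom "\<lambda>c. [:c:] :: 'a mpoly poly" by unfold_locales auto
  have "eval_monomial (\<lambda>k. [:0, 1:] * [:mVar k:]) l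
      = ([:0, 1:] :: 'a mpoly poly) ^ (\<Sum>k\<in>Poly_Mapping.keys l. Poly_Mapping.lookup l k)
        * [:eval_monomial mVar l:]"
    by (simp only: eval_monomial_def power_mult_distrib prod.distrib power_sum L.hom_prod L.hom_power)
  moreover have "mConst c * eval_monomial mVar l = Poly_Mapping.single l c"
    using eval_mpoly_mVar_id[of "Poly_Mapping.single l c"]
    by (simp add: eval_mpoly_single[OF comm_ring_hom_mConst])
  ultimately have "[:mConst c:] * eval_monomial (\<lambda>k. [:0, 1:] * [:mVar k:]) l
      = Polynomial.monom (Poly_Mapping.single l c) (\<Sum>k\<in>Poly_Mapping.keys l. Poly_Mapping.lookup l k)"
    unfolding Polynomial.monom_altdef
    by (simp only: mult.left_commute[of "[:mConst c:]"]) (simp add: mult.commute)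
  then show ?case
    by (auto simp: eval_mpoly_single[OF hom] lookup_single when_def)
next
  case (add P R)
  note hom = comm_ring_hom_const_mConst
  show ?case using add by (simp add: eval_mpoly_add[OF hom] lookup_add)
qed

text \<open>The quotient H of the determinant by the power of the Vandermonde product is homogeneous
  of degree 0: scaling all variables leaves it unchanged. Hence it is a constant.\<close>

lemma det_eq_const_mult_vandermonde_prod:
  fixes g :: nat
  defines "D \<equiv> \<lambda>p r e d. det (coeff_mat p (root_poly r (mVar :: nat \<Rightarrow> 'a::idom mpoly) ^ e) d)"
  assumes d: "d \<le> p" and nz: "D p r e d \<noteq> 0" and g: "g > 0"
    and dvd: "vandermonde_prod r mVar ^ g dvd D p r e d"
    and deg: "p * d * (d + 1) + d * (d - 1) + g * (r * (r - 1)) = 2 * d * (r * e + d)"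
  shows "\<exists>c. c \<noteq> 0 \<and> D p r e d = mConst c * vandermonde_prod r mVar ^ g"
proof -
  let ?V = "vandermonde_prod r mVar :: 'a mpoly"
  let ?h = "\<lambda>c. [:mConst c:] :: 'a mpoly poly"
  let ?\<phi> = "eval_mpoly ?h (\<lambda>k. [:0, 1:] * [:mVar k:])"
  let ?s = "[:0, 1:] :: 'a mpoly poly"
  obtain H where H: "D p r e d = ?V ^ g * H" using dvd by (elim dvdE)
  have V: "?V \<noteq> 0" using nz H g by auto
  have hom: "comm_ring_hom ?h" by (rule comm_ring_hom_const_mConst)
  interpret L: comm_ring_hom "\<lambda>c. [:c:] :: 'a mpoly poly" by unfold_locales auto
  interpret E: comm_ring_hom ?\<phi> by (rule eval_mpoly_hom[OF hom])
  let ?E1 = "(\<Sum>i = 0..<d. p + i * p) + (\<Sum>i = 0..<d. i)"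
  let ?E2 = "d * (r * e + d)"
  let ?N = "card {(i::nat, j). i < j \<and> j < r}"
  have "?s ^ ?E1 * ?\<phi> (D p r e d) = ?s ^ ?E2 * [:D p r e d:]"
    unfolding D_def eval_det[OF hom] det_scaled_root_poly[OF d]
    by (simp only: L.det_coeff_mat_hom[symmetric] L.map_root_poly)
  moreover have "?\<phi> ?V = ?s ^ ?N * [:?V:]"
    unfolding eval_vandermonde_prod[OF hom] vandermonde_prod_scaled L.vandermonde_prod_hom ..
  ultimately have "?s ^ ?E1 * ((?s ^ ?N * [:?V:]) ^ g * ?\<phi> H) = ?s ^ ?E2 * ([:?V:] ^ g * [:H:])"
    unfolding H by (simp only: hom_distribs)
  then have "(?s ^ ?E1 * ?s ^ (g * ?N)) * ([:?V:] ^ g * ?\<phi> H) = ?s ^ ?E2 * ([:?V:] ^ g * [:H:])"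
    by (simp only: power_mult_distrib power_mult[symmetric] mult_ac)
  then have "?s ^ ?E2 * ([:?V:] ^ g * ?\<phi> H) = ?s ^ ?E2 * ([:?V:] ^ g * [:H:])"
    by (simp only: power_add[symmetric] weights_eq_of_degree_eq[OF deg])
  moreover have "?s ^ ?E2 \<noteq> 0" "[:?V:] ^ g \<noteq> 0" using V by simp_all
  ultimately have \<phi>H: "?\<phi> H = [:H:]" by (metis mult_left_cancel)
  have "Poly_Mapping.lookup H m = 0" if m: "m \<noteq> 0" for m
  proof -
    let ?n = "\<Sum>k\<in>Poly_Mapping.keys m. Poly_Mapping.lookup m k"
    have "Poly_Mapping.keys m \<noteq> {}" using m by simp
    then obtain k where "k \<in> Poly_Mapping.keys m" by blast
    then have "?n \<noteq> 0" by (auto simp: in_keys_iff)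
    then show ?thesis
      using lookup_coeff_eval_scaled[of H ?n m] \<phi>H by (simp add: coeff_pCons split: nat.splits)
  qed
  then have "H = mConst (Poly_Mapping.lookup H 0)"
    by (intro poly_mapping_eqI) (auto simp: mConst_def lookup_single when_def)
  moreover from this have "Poly_Mapping.lookup H 0 \<noteq> 0" using nz H by (auto simp: mConst_def)
  ultimately show ?thesis using H by (metis mult.commute)
qed

section \<open>Specialization to two-term polynomials\<close>

text \<open>Every monic polynomial is a specialization of the generic one, so the determinant can be
  tested on polynomials given by their coefficients.\<close>

lemma root_poly_exists:
  fixes P :: "'a::alg_closed_field poly"
  assumes "Polynomial.lead_coeff P = 1" "Polynomial.degree P = r"
  shows "\<exists>v. root_poly r v = P"
proof -
  have "P \<noteq> 0" using assms(1) by auto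
  then obtain A where A: "size A = Polynomial.degree P"
      "P = Polynomial.smult (Polynomial.lead_coeff P) (\<Prod>x\<in>#A. [:- x, 1:])"
    using alg_closed_imp_factorization by blast
  obtain xs where xs: "mset xs = A" using ex_mset by blast
  have "P = (\<Prod>x\<leftarrow>xs. [:- x, 1:])"
    using A(2) assms(1) by (simp add: prod_mset_prod_list mset_map[symmetric] del: mset_map flip: xs)
  also have "\<dots> = (\<Prod>k<length xs. [:- (xs ! k), 1:])"
    by (simp add: prod.list_conv_set_nth atLeast0LessThan)
  finally have "root_poly r (\<lambda>k. xs ! k) = P"
    using A(1) xs assms(2) by (auto simp: root_poly_def)
  then show ?thesis by blast
qed

section \<open>The test polynomials x^r - 1 (a = 0, b = r) and x^r - x (a = 1, b = r - 1)\<close>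

definition two_term :: "nat \<Rightarrow> nat \<Rightarrow> 'a::comm_ring_1 poly" where
  "two_term a b = Polynomial.monom 1 a * (Polynomial.monom 1 b - 1)"

lemma binomial_not_dvd_prime:
  assumes "prime p" "e < p" "k \<le> e"
  shows "\<not> p dvd (e choose k)"
proof
  assume "p dvd (e choose k)"
  also have "(e choose k) dvd fact e"
    using binomial_fact_lemma[OF assms(3)] by (metis dvd_triv_right)
  finally show False using assms by (simp add: prime_dvd_fact_iff)
qed

text \<open>No terms cancel, since b > 0 makes the exponents distinct, and the binomial coefficients
  are nonzero modulo p because e < p.\<close>

lemma coeff_two_term_power_nonzero_iff:
  assumes "prime p" "CHAR('a::idom) = p" "e < p" "b > 0"
  shows "Polynomial.coeff (two_term a b ^ e :: 'a poly) n \<noteq> 0 \<longleftrightarrow> (\<exists>k\<le>e. n = a * e + b * k)"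
proof -
  let ?t = "\<lambda>k. of_nat (e choose k) * (- 1) ^ (e - k) :: 'a"
  have "(Polynomial.monom 1 b - 1 :: 'a poly) ^ e
      = (Polynomial.monom 1 b + [:- 1:]) ^ e"
    by (metis diff_conv_add_uminus minus_pCons minus_zero one_pCons)
  also have "\<dots> = (\<Sum>k\<le>e. of_nat (e choose k) * Polynomial.monom 1 b ^ k * [:- 1:] ^ (e - k))"
    by (rule binomial_ring)
  also have "\<dots> = (\<Sum>k\<le>e. Polynomial.monom (?t k) (b * k))"
    by (intro sum.cong refl)
      (simp add: Polynomial.monom_power poly_const_pow of_nat_poly Polynomial.smult_monom mult.commute)
  finally have "two_term a b ^ e = (\<Sum>k\<le>e. Polynomial.monom (?t k) (a * e + b * k))"
    by (simp add: two_term_def power_mult_distrib Polynomial.monom_power sum_distrib_left Polynomial.mult_monom)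
  then have cf: "Polynomial.coeff (two_term a b ^ e :: 'a poly) n
      = (\<Sum>k\<le>e. if a * e + b * k = n then ?t k else 0)"
    by (simp add: Polynomial.coeff_sum)
  have "of_nat (e choose k) \<noteq> (0 :: 'a)" if "k \<le> e" for k
    using binomial_not_dvd_prime[OF assms(1,3) that] assms(2) by (simp add: of_nat_eq_0_iff_char_dvd)
  then have t: "?t k \<noteq> 0" if "k \<le> e" for k using that by simp
  show ?thesis
  proof (cases "\<exists>k\<le>e. n = a * e + b * k")
    case True
    then obtain k where k: "k \<le> e" "n = a * e + b * k" by blast
    then have "Polynomial.coeff (two_term a b ^ e :: 'a poly) n = (\<Sum>l\<le>e. if l = k then ?t l else 0)"
      unfolding cf using assms(4) by (intro sum.cong) auto
    also have "\<dots> = ?t k" using k(1) by simp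
    finally show ?thesis using t[OF k(1)] True by simp
  next
    case False
    then show ?thesis unfolding cf by (auto intro!: sum.neutral)
  qed
qed

lemma det_row_injection_pattern:
  fixes A :: "'a::idom mat"
  assumes A: "A \<in> carrier_mat n n" and f: "inj_on f {0..<n}" "\<And>i. i < n \<Longrightarrow> f i < n"
    and nz: "\<And>i j. i < n \<Longrightarrow> j < n \<Longrightarrow> A $$ (i, j) \<noteq> 0 \<longleftrightarrow> j = f i"
  shows "det A \<noteq> 0"
proof (rule det_monomial_pattern[OF A])
  have "f ` {0..<n} = {0..<n}"
    by (rule endo_inj_surj) (use f in auto)
  then have "bij_betw f {0..<n} {0..<n}" using f(1) by (simp add: bij_betw_def)
  then have "bij_betw (\<lambda>i. if i < n then f i else i) {0..<n} {0..<n}"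
    by (subst bij_betw_cong[of _ _ f]) auto
  then show "(\<lambda>i. if i < n then f i else i) permutes {0..<n}"
    by (rule bij_imp_permutes) auto
qed (use nz in auto)

lemma cong_imp_eq_of_pos_le:
  fixes x y r :: nat
  assumes "[x = y] (mod r)" "0 < x" "x \<le> r" "0 < y" "y \<le> r"
  shows "x = y"
proof -
  have "r dvd x \<longleftrightarrow> r dvd y" using assms(1) by (rule cong_dvd_iff)
  then show ?thesis using assms
    by (cases "x = r"; cases "y = r") (auto simp: cong_def dest: dvd_imp_le)
qed

text \<open>Row i reads the indices (i+1)p - t with 1 <= t <= d, and the nonzero coefficients sit at
  multiples of r. By the last hypothesis and d <= r exactly one t fits; coprimality makes different
  rows choose different t.\<close>

lemma det_two_term_0_nonzero:
  fixes p :: nat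
  assumes p: "prime p" "CHAR('a::idom) = p" and e: "e < p" and r: "coprime p r" "d \<le> r" "r > 0"
    and d: "d \<le> p" and low: "d * (p - 1) \<le> r * e"
    and t: "\<And>i. i < d \<Longrightarrow> \<exists>t. 1 \<le> t \<and> t \<le> d \<and> [(i + 1) * p = t] (mod r)"
  shows "det (coeff_mat p (two_term 0 r ^ e :: 'a poly) d) \<noteq> 0"
proof -
  have "\<forall>i. \<exists>s. i < d \<longrightarrow> 1 \<le> s \<and> s \<le> d \<and> [(i + 1) * p = s] (mod r)"
    using t by blast
  from choice[OF this] obtain t
    where t: "\<And>i. i < d \<Longrightarrow> 1 \<le> t i \<and> t i \<le> d \<and> [(i + 1) * p = t i] (mod r)"
    by blast
  show ?thesis
  proof (rule det_row_injection_pattern)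
    show "inj_on (\<lambda>i. d - t i) {0..<d}"
    proof (rule inj_onI)
      fix i j assume ij: "i \<in> {0..<d}" "j \<in> {0..<d}" "d - t i = d - t j"
      then have "t i = t j" using t[of i] t[of j] by auto
      then have "[(i + 1) * p = (j + 1) * p] (mod r)"
        using t[of i] t[of j] ij by (simp add: cong_def)
      then have "[i + 1 = j + 1] (mod r)" using r(1) by (simp only: cong_mult_rcancel_nat)
      then have "[i = j] (mod r)" by (simp only: cong_add_rcancel_nat)
      then show "i = j" using ij r(2) by (auto simp: cong_def)
    qed
    fix i j assume ij: "i < d" "j < d"
    let ?n = "p + i * p + j - d"
    have n: "?n + (d - j) = (i + 1) * p" using ij d by (simp add: trans_le_add1)
    have "Polynomial.coeff (two_term 0 r ^ e :: 'a poly) ?n \<noteq> 0 \<longleftrightarrow> (\<exists>k\<le>e. ?n = r * k)"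
      using coeff_two_term_power_nonzero_iff[OF p e r(3), of 0 ?n] by simp
    also have "\<dots> \<longleftrightarrow> r dvd ?n"
    proof
      assume "r dvd ?n"
      then obtain k where k: "?n = r * k" by (elim dvdE)
      \<comment> \<open>A multiple of r beyond re is at least re + r >= d(p-1) + d = dp, but all
        indices stay below dp.\<close>
      have "k \<le> e"
      proof (rule ccontr)
        assume "\<not> k \<le> e"
        then have "r * Suc e \<le> ?n" unfolding k by (intro mult_le_mono2) simp
        then have "d * (p - 1) + r \<le> ?n" using low by simp
        moreover have "d * (p - 1) + d = d * p" using d ij by (cases p) auto
        moreover have "(i + 1) * p \<le> d * p" using ij by (intro mult_le_mono1) simp
        ultimately show False using n r(2) ij by linarith
      qed
      with k show "\<exists>k\<le>e. ?n = r * k" by blast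
    qed auto
    also have "\<dots> \<longleftrightarrow> [(i + 1) * p = d - j] (mod r)"
      unfolding n[symmetric] by (simp add: cong_0_iff[symmetric] cong_add_rcancel_0_nat)
    also have "\<dots> \<longleftrightarrow> [t i = d - j] (mod r)"
      using t[OF ij(1)] by (simp only: cong_def)
    also have "\<dots> \<longleftrightarrow> t i = d - j"
    proof
      assume "[t i = d - j] (mod r)"
      then show "t i = d - j"
        by (rule cong_imp_eq_of_pos_le) (use t[OF ij(1)] ij r(2) in linarith)+
    qed auto
    also have "\<dots> \<longleftrightarrow> j = d - t i" using t[OF ij(1)] ij by auto
    finally show "coeff_mat p (two_term 0 r ^ e :: 'a poly) d $$ (i, j) \<noteq> 0 \<longleftrightarrow> j = d - t i"
      using ij by simp
  next
    show "d - t i < d" if "i < d" for i using t[OF that] that by (intro diff_less) simp_all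
  qed simp
qed

text \<open>The exponents of (x^p - x)^(p-1) are (k+1)(p-1) = (k+1)p - (k+1), so row i meets one
  only for k = i, and the nonzero entries form the antidiagonal.\<close>

lemma det_two_term_1_nonzero:
  fixes p :: nat
  assumes p: "prime p" "CHAR('a::idom) = p" and d: "d \<le> p"
  shows "det (coeff_mat p (two_term 1 (p - 1) ^ (p - 1) :: 'a poly) d) \<noteq> 0"
proof (rule det_row_injection_pattern)
  show "inj_on (\<lambda>i. d - 1 - i) {0..<d}" by (auto simp: inj_on_def)
  fix i j assume ij: "i < d" "j < d"
  let ?n = "p + i * p + j - d"
  have p2: "p \<ge> 2" using p(1) by (rule prime_ge_2_nat)
  have n: "?n + (d - j) = p + i * p" using ij d by (simp add: trans_le_add1)
  have "Polynomial.coeff (two_term 1 (p - 1) ^ (p - 1) :: 'a poly) ?n \<noteq> 0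
      \<longleftrightarrow> (\<exists>k\<le>p - 1. ?n = (p - 1) + (p - 1) * k)"
    using coeff_two_term_power_nonzero_iff[OF p, of "p - 1" "p - 1" 1 ?n] p2 by simp
  also have "\<dots> \<longleftrightarrow> (\<exists>k\<le>p - 1. ?n + (k + 1) = p + p * k)"
  proof -
    have "(p - 1) + (p - 1) * k + (k + 1) = p + p * k" for k
      using p2 by (cases p) (auto simp: algebra_simps)
    then show ?thesis by (metis add_right_cancel)
  qed
  also have "\<dots> \<longleftrightarrow> j = d - 1 - i"
  proof
    assume "\<exists>k\<le>p - 1. ?n + (k + 1) = p + p * k"
    then obtain k where k: "k \<le> p - 1" "?n + (k + 1) = p + p * k" by blast
    have "k = i"
    proof (rule ccontr)
      assume "k \<noteq> i"
      then consider "k + 1 \<le> i" | "i + 1 \<le> k" by linarith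
      then show False
      proof cases
        case 1
        then have "(k + 1) * p \<le> i * p" by (rule mult_le_mono1)
        then show False using n k ij d p2 by (simp add: algebra_simps)
      next
        case 2
        then have "(i + 1) * p \<le> k * p" by (rule mult_le_mono1)
        then show False using n k ij d p2 by (simp add: algebra_simps)
      qed
    qed
    then show "j = d - 1 - i" using k n ij by (simp add: algebra_simps)
  next
    assume "j = d - 1 - i"
    then have "?n + (i + 1) = p + p * i" using n ij by (simp add: algebra_simps)
    then show "\<exists>k\<le>p - 1. ?n + (k + 1) = p + p * k" using ij d by (intro exI[of _ i]) auto
  qed
  finally show "coeff_mat p (two_term 1 (p - 1) ^ (p - 1) :: 'a poly) d $$ (i, j) \<noteq> 0
      \<longleftrightarrow> j = d - 1 - i"
    using ij by simp
qed auto

lemma comm_ring_hom_to_ac: "comm_ring_hom (to_ac :: 'a::field \<Rightarrow> 'a alg_closure)"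
  by unfold_locales auto

lemma two_term_monic:
  assumes "b > 0"
  shows "Polynomial.lead_coeff (two_term a b :: 'a::idom poly) = 1"
    and "Polynomial.degree (two_term a b :: 'a::idom poly) = a + b"
proof -
  have lt: "Polynomial.degree (Polynomial.monom 1 b + [:- 1:] :: 'a poly) = b"
    using assms by (subst degree_add_eq_left) (simp_all add: degree_monom_eq)
  have eq: "Polynomial.monom 1 b - 1 = (Polynomial.monom 1 b + [:- 1:] :: 'a poly)"
    by (metis diff_conv_add_uminus minus_pCons minus_zero one_pCons)
  have "Polynomial.coeff (Polynomial.monom 1 b + [:- 1:] :: 'a poly) b = 1"
    using assms by (simp add: coeff_pCons split: nat.splits)
  then have lc: "Polynomial.lead_coeff (Polynomial.monom 1 b + [:- 1:] :: 'a poly) = 1"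
    by (simp only: lt)
  then have nz: "(Polynomial.monom 1 b + [:- 1:] :: 'a poly) \<noteq> 0" by force
  show "Polynomial.lead_coeff (two_term a b :: 'a poly) = 1"
    unfolding two_term_def eq Polynomial.lead_coeff_mult lc by (simp add: degree_monom_eq)
  show "Polynomial.degree (two_term a b :: 'a poly) = a + b"
    unfolding two_term_def eq
    by (subst degree_mult_eq) (use nz in \<open>simp_all add: lt degree_monom_eq monom_eq_0_iff\<close>)
qed

lemma two_term_root_poly:
  assumes "b > 0"
  shows "\<exists>v. root_poly (a + b) v = (two_term a b :: 'a::alg_closed_field poly)"
  using root_poly_exists two_term_monic[OF assms] by blast

text \<open>A repeated root would be a zero of the derivative. At a nonzero root z the derivative is
  b z^(a+b-1); at the root 0, present only for a = 1, it is -1.\<close>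

lemma root_poly_two_term_distinct:
  fixes v :: "nat \<Rightarrow> 'a::field"
  assumes a: "a \<le> 1" and b: "b > 0" "of_nat b \<noteq> (0 :: 'a)"
    and v: "root_poly (a + b) v = two_term a b"
  shows "inj_on v {..<a + b}"
proof (rule inj_onI, rule ccontr)
  fix i j assume ij: "i \<in> {..<a + b}" "j \<in> {..<a + b}" "v i = v j" "i \<noteq> j"
  let ?z = "v i" and ?R = "\<Prod>k\<in>{..<a + b} - {i} - {j}. [:- v k, 1:]"
  have "root_poly (a + b) v = [:- v i, 1:] * ([:- v j, 1:] * ?R)"
    unfolding root_poly_def using ij
    by (subst prod.remove[of _ i], simp, simp, subst prod.remove[of _ j]) auto
  then have P: "two_term a b = [:- ?z, 1:] * ([:- ?z, 1:] * ?R)" using v ij(3) by simp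
  have "poly (two_term a b) ?z = 0" unfolding P by simp
  moreover have "poly (pderiv (two_term a b)) ?z = 0"
    unfolding P by (simp only: pderiv_mult poly_add poly_mult) simp
  ultimately have z: "?z ^ a * (?z ^ b - 1) = 0"
    and z': "?z ^ a * (of_nat b * ?z ^ (b - 1)) + (?z ^ b - 1) * (of_nat a * ?z ^ (a - 1)) = 0"
    by (simp_all add: two_term_def poly_monom pderiv_mult pderiv_monom pderiv_diff pderiv_1)
  from a consider "a = 0" | "a = 1" by linarith
  then show False
  proof cases
    case 1
    then show False using z z' b by (cases "?z = 0") (auto simp: zero_power)
  next
    case 2
    then show False using z z' b by (cases "?z = 0") (auto simp: zero_power)
  qed
qed

text \<open>p cannot divide both r and r - 1, so x^r - 1 or x^r - x is separable; a translation then
  moves one root to 0.\<close>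

lemma exists_distinct_values:
  assumes "prime p" "CHAR('a::alg_closed_field) = p" "r \<ge> 2"
  shows "\<exists>v :: nat \<Rightarrow> 'a. inj_on v {..<r} \<and> v 0 = 0"
proof -
  have "\<exists>v :: nat \<Rightarrow> 'a. inj_on v {..<r}"
  proof (cases "p dvd r")
    case False
    then have "of_nat r \<noteq> (0 :: 'a)" using assms by (simp add: of_nat_eq_0_iff_char_dvd)
    moreover obtain v where "root_poly (0 + r) v = (two_term 0 r :: 'a poly)"
      using two_term_root_poly[of r 0] assms(3) by auto
    ultimately show ?thesis
      using root_poly_two_term_distinct[of 0 r v] assms(3) by auto
  next
    case True
    have "\<not> p dvd r - 1"
    proof
      assume "p dvd r - 1"
      with True have "p dvd r - (r - 1)" by (rule dvd_diff_nat)
      then show False using assms by (simp add: prime_gt_1_nat)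
    qed
    then have "of_nat (r - 1) \<noteq> (0 :: 'a)" unfolding of_nat_eq_0_iff_char_dvd assms(2) .
    moreover obtain v where "root_poly (1 + (r - 1)) v = (two_term 1 (r - 1) :: 'a poly)"
      using two_term_root_poly[of "r - 1" 1] assms(3) by auto
    ultimately show ?thesis
      using root_poly_two_term_distinct[of 1 "r - 1" v] assms(3) by auto
  qed
  then obtain v :: "nat \<Rightarrow> 'a" where "inj_on v {..<r}" by blast
  then have "inj_on (\<lambda>k. v k - v 0) {..<r} \<and> v 0 - v 0 = 0" by (auto simp: inj_on_def)
  then show ?thesis by (rule exI[of _ "\<lambda>k. v k - v 0"])
qed

lemma vandermonde_prod_nonzero_iff:
  "vandermonde_prod r (v :: nat \<Rightarrow> 'a::idom) \<noteq> 0 \<longleftrightarrow> inj_on v {..<r}"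
proof -
  have "vandermonde_prod r v \<noteq> 0 \<longleftrightarrow> (\<forall>i j. i < j \<and> j < r \<longrightarrow> v i \<noteq> v j)"
    by (auto simp: vandermonde_prod_def prod_zero_iff)
  also have "\<dots> \<longleftrightarrow> inj_on v {..<r}"
  proof
    assume *: "\<forall>i j. i < j \<and> j < r \<longrightarrow> v i \<noteq> v j"
    show "inj_on v {..<r}"
    proof (rule inj_onI, rule ccontr)
      fix i j assume ij: "i \<in> {..<r}" "j \<in> {..<r}" "v i = v j" "i \<noteq> j"
      then consider "i < j" | "j < i" by linarith
      then show False using * ij by cases (metis lessThan_iff)+
    qed
  qed (fastforce simp: inj_on_def)
  finally show ?thesis .
qed

section \<open>Degree in one distinguished root, played by the inner polynomial variable\<close>

lemma coeff_degree_le_mult: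
  fixes P Q :: "'a::comm_ring_1 poly poly"
  assumes "\<And>n. Polynomial.degree (Polynomial.coeff P n) \<le> k"
    and "\<And>n. Polynomial.degree (Polynomial.coeff Q n) \<le> l"
  shows "Polynomial.degree (Polynomial.coeff (P * Q) n) \<le> k + l"
  unfolding Polynomial.coeff_mult
  by (intro degree_sum_le order.trans[OF degree_mult_le] add_mono assms) simp

lemma coeff_degree_le_power:
  fixes P :: "'a::comm_ring_1 poly poly"
  assumes "\<And>n. Polynomial.degree (Polynomial.coeff P n) \<le> k"
  shows "Polynomial.degree (Polynomial.coeff (P ^ e) n) \<le> e * k"
proof (induction e arbitrary: n)
  case 0
  show ?case by (simp add: one_pCons coeff_pCons split: nat.splits)
next
  case (Suc e)
  show ?case using coeff_degree_le_mult[OF assms Suc] by simp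
qed

lemma coeff_degree_le_root_poly:
  fixes v :: "nat \<Rightarrow> 'a::comm_ring_1 poly"
  assumes "Polynomial.degree (v 0) \<le> 1" "\<And>k. k > 0 \<Longrightarrow> Polynomial.degree (v k) = 0"
  shows "Polynomial.degree (Polynomial.coeff (root_poly r v) n) \<le> 1"
proof -
  have "Polynomial.degree (Polynomial.coeff (root_poly (Suc r) v) n) \<le> 1" for r n
  proof (induction r arbitrary: n)
    case 0
    show ?case using assms(1)
      by (simp add: root_poly_def coeff_pCons split: nat.splits)
  next
    case (Suc r)
    have "Polynomial.degree (Polynomial.coeff [:- v (Suc r), 1:] n) \<le> 0" for n
      using assms(2)[of "Suc r"] by (simp add: coeff_pCons split: nat.splits)
    from coeff_degree_le_mult[OF Suc this] show ?case by (simp only: root_poly_Suc[of "Suc r"] add_0_right)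
  qed
  then show ?thesis
  proof (cases r)
    case 0
    then show ?thesis by (simp add: root_poly_def one_pCons coeff_pCons split: nat.splits)
  qed simp
qed

lemma det_2:
  fixes A :: "'a::comm_ring_1 mat"
  assumes A: "A \<in> carrier_mat 2 2"
  shows "det A = A $$ (0, 0) * A $$ (1, 1) - A $$ (0, 1) * A $$ (1, 0)"
proof -
  have "det (mat_delete A 0 j) = A $$ (1, 1 - j)" if "j < 2" for j
    using A that by (subst det_single) (auto simp: mat_delete_def less_2_cases_iff)
  then show ?thesis
    unfolding laplace_expansion_row[OF A, of 0, simplified]
    by (simp add: numeral_2_eq_2 cofactor_def)
qed

section \<open>Consequences of the determinant being a power of the Vandermonde product\<close>

locale vandermonde_power_det =
  fixes p r e d g :: nat and \<epsilon> :: "'p::prime_card mod_ring"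
  assumes p: "p = CARD('p)"
    and r2: "r \<ge> 2" and e1: "e \<ge> 1" and d1: "d \<ge> 1" and dp: "d \<le> p"
    and \<epsilon>: "\<epsilon> \<noteq> 0" and g: "g > 0"
    and det_eq: "det (coeff_mat p (root_poly r mVar ^ e) d)
      = mConst \<epsilon> * vandermonde_prod r (mVar :: nat \<Rightarrow> 'p mod_ring mpoly) ^ g"
begin

lemma p_prime: "prime p"
  unfolding p by (rule prime_card)

lemma CHAR_ac: "CHAR('p mod_ring alg_closure) = p"
  by (simp add: p)

lemma det_eval:
  assumes h: "comm_ring_hom (h :: 'p mod_ring \<Rightarrow> 'b::comm_ring_1)"
  shows "det (coeff_mat p (root_poly r v ^ e) d) = h \<epsilon> * vandermonde_prod r v ^ g"
proof -
  interpret E: comm_ring_hom "eval_mpoly h v" by (rule eval_mpoly_hom[OF h])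
  show ?thesis
    unfolding eval_det[OF h, symmetric] det_eq
    by (simp only: E.hom_mult E.hom_power eval_mpoly_mConst[OF h] eval_vandermonde_prod[OF h])
qed

lemma det_distinct_nonzero:
  fixes v :: "nat \<Rightarrow> 'p mod_ring alg_closure"
  assumes "inj_on v {..<r}"
  shows "det (coeff_mat p (root_poly r v ^ e) d) \<noteq> 0"
  using assms \<epsilon> by (simp add: det_eval[OF comm_ring_hom_to_ac] vandermonde_prod_nonzero_iff)

lemma distinct_values:
  obtains v :: "nat \<Rightarrow> 'p mod_ring alg_closure" where "inj_on v {..<r}" "v 0 = 0"
  using exists_distinct_values[OF p_prime CHAR_ac r2] by blast

text \<open>For a separable f with root 0, x^e divides f^e. If e >= p, this kills the whole first
  row, whose indices are below p.\<close>

lemma e_less: "e < p"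
proof (rule ccontr)
  assume "\<not> e < p"
  obtain v :: "nat \<Rightarrow> 'p mod_ring alg_closure" where v: "inj_on v {..<r}" "v 0 = 0"
    by (rule distinct_values)
  have "root_poly r v = [:- v 0, 1:] * (\<Prod>k\<in>{..<r} - {0}. [:- v k, 1:])"
    unfolding root_poly_def using r2 by (intro prod.remove) auto
  then have "root_poly r v ^ e = Polynomial.monom 1 e * (\<Prod>k\<in>{..<r} - {0}. [:- v k, 1:]) ^ e"
    using v(2) by (simp only: power_mult_distrib) (simp add: Polynomial.monom_altdef)
  moreover obtain j where "j < d" "coeff_mat p (root_poly r v ^ e) d $$ (0, j) \<noteq> 0"
    using exists_nonzero_in_row[OF coeff_mat_carrier det_distinct_nonzero[OF v(1)], of 0] d1 by auto
  moreover have "p + j - d < e" if "j < d" for j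
    using that \<open>\<not> e < p\<close> prime_gt_0_nat[OF p_prime] by linarith
  ultimately show False by (simp add: Polynomial.coeff_monom_mult)
qed

text \<open>The last row must contain a nonzero entry. Its indices are at least dp - d, and f^e has
  degree at most re.\<close>

lemma degree_lower_bound: "d * (p - 1) \<le> r * e"
proof -
  obtain v :: "nat \<Rightarrow> 'p mod_ring alg_closure" where v: "inj_on v {..<r}"
    by (rule distinct_values)
  obtain j where j: "j < d" "coeff_mat p (root_poly r v ^ e) d $$ (d - 1, j) \<noteq> 0"
    using exists_nonzero_in_row[OF coeff_mat_carrier det_distinct_nonzero[OF v], of "d - 1"] d1 by auto
  have "d * p = p + (d - 1) * p" using d1 by (cases d) auto
  then have "d * (p - 1) \<le> p + (d - 1) * p + j - d" by (simp add: right_diff_distrib')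
  also have "\<dots> \<le> Polynomial.degree (root_poly r v ^ e)"
    using j by (intro le_degree) simp
  also have "\<dots> \<le> Polynomial.degree (root_poly r v) * e" by (rule degree_power_le)
  also have "\<dots> \<le> r * e" using degree_root_poly_le[of v "{..<r}"] by (simp add: root_poly_def)
  finally show ?thesis .
qed

lemma comm_ring_hom_to_ac_poly: "comm_ring_hom (\<lambda>c. [:to_ac c:] :: 'p mod_ring alg_closure poly)"
  by unfold_locales auto

text \<open>Specializing to roots s v_k, with s an indeterminate and the v_k distinct constants,
  turns both sides of \<open>det_eq\<close> into powers of s times a common nonzero factor; the
  exponents must agree.\<close>

lemma degree_equation: "p * d * (d + 1) + d * (d - 1) + g * (r * (r - 1)) = 2 * d * (r * e + d)"
proof -
  obtain v :: "nat \<Rightarrow> 'p mod_ring alg_closure" where v: "inj_on v {..<r}"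
    by (rule distinct_values)
  let ?s = "[:0, 1:] :: 'p mod_ring alg_closure poly" and ?v = "\<lambda>k. [:v k:]"
  let ?A = "(\<Sum>i = 0..<d. p + i * p) + (\<Sum>i = 0..<d. i)"
  let ?C = "card {(i::nat, j). i < j \<and> j < r}"
  have "vandermonde_prod r ?v \<noteq> 0"
    unfolding vandermonde_prod_nonzero_iff using v by (simp add: inj_on_def)
  moreover have "?s ^ ?A * ([:to_ac \<epsilon>:] * (?s ^ ?C * vandermonde_prod r ?v) ^ g)
      = ?s ^ (d * (r * e + d)) * ([:to_ac \<epsilon>:] * vandermonde_prod r ?v ^ g)"
    using det_scaled_root_poly[OF dp, of ?s r ?v e]
    by (simp only: det_eval[OF comm_ring_hom_to_ac_poly] vandermonde_prod_scaled)
  then have "?s ^ (?A + g * ?C) * ([:to_ac \<epsilon>:] * vandermonde_prod r ?v ^ g)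
      = ?s ^ (d * (r * e + d)) * ([:to_ac \<epsilon>:] * vandermonde_prod r ?v ^ g)"
    by (simp only: power_add power_mult_distrib power_mult[symmetric] mult_ac)
  ultimately have "?s ^ (?A + g * ?C) = ?s ^ (d * (r * e + d))"
    using \<epsilon> by (subst (asm) mult_right_cancel) auto
  then have "Polynomial.degree (?s ^ (?A + g * ?C)) = Polynomial.degree (?s ^ (d * (r * e + d)))"
    by (rule arg_cong)
  then have "?A + g * ?C = d * (r * e + d)" by (simp only: degree_linear_power)
  then have "2 * ?A + g * (2 * ?C) = 2 * (d * (r * e + d))" by simp
  then show ?thesis unfolding twice_row_col_weights card_index_pairs by (simp only: mult.assoc)
qed

text \<open>Comparing degrees in $x_1$: each entry of the matrix has degree at most $e$.\<close>

lemma degree_first_variable: "g * (r - 1) \<le> e * d"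
proof -
  obtain v :: "nat \<Rightarrow> 'p mod_ring alg_closure" where v: "inj_on v {..<r}"
    by (rule distinct_values)
  \<comment> \<open>The other roots stay distinct constants, so exactly the r - 1 factors x_1 - x_j
    of the Vandermonde product have degree 1.\<close>
  let ?v = "\<lambda>k. if k = 0 then [:0, 1:] else [:v k:]"
  let ?D = "det (coeff_mat p (root_poly r ?v ^ e) d)"
  have v_neq: "v i \<noteq> v j" if "i < j" "j < r" for i j
    using inj_onD[OF v, of i j] that by auto
  have nz: "(case x of (i, j) \<Rightarrow> ?v i - ?v j) \<noteq> 0" if "x \<in> {(i, j). i < j \<and> j < r}" for x
    using that v_neq by (auto split: if_splits)
  have "Polynomial.degree ?D \<le> e * d"
  proof (rule degree_det_le[OF _ coeff_mat_carrier])
    fix i j assume "i < d" "j < d"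
    moreover have "Polynomial.degree (Polynomial.coeff (root_poly r ?v ^ e) n) \<le> e * 1" for n
      by (intro coeff_degree_le_power coeff_degree_le_root_poly) auto
    ultimately show "Polynomial.degree (coeff_mat p (root_poly r ?v ^ e) d $$ (i, j)) \<le> e" by simp
  qed
  moreover have "Polynomial.degree (vandermonde_prod r ?v) = r - 1"
  proof -
    have "Polynomial.degree (vandermonde_prod r ?v)
        = (\<Sum>x\<in>{(i, j). i < j \<and> j < r}. Polynomial.degree (case x of (i, j) \<Rightarrow> ?v i - ?v j))"
      unfolding vandermonde_prod_def using nz by (intro degree_prod_eq_sum_degree) blast
    also have "\<dots> = (\<Sum>x\<in>{(i, j). i < j \<and> j < r}. if fst x = 0 then 1 else 0)"
      by (intro sum.cong) auto
    also have "\<dots> = card {x \<in> {(i, j). i < j \<and> j < r}. fst x = 0}"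
      by (simp add: sum.inter_filter[symmetric])
    also have "{x \<in> {(i, j). i < j \<and> j < r}. fst x = 0} = Pair 0 ` {1..<r}"
      by auto
    also have "card \<dots> = r - 1" by (simp add: card_image inj_on_def)
    finally show ?thesis .
  qed
  moreover have "?D = [:to_ac \<epsilon>:] * vandermonde_prod r ?v ^ g"
    by (rule det_eval[OF comm_ring_hom_to_ac_poly])
  moreover have "vandermonde_prod r ?v \<noteq> 0"
    unfolding vandermonde_prod_def using nz by (subst prod_zero_iff) auto
  ultimately show ?thesis using \<epsilon> by (simp add: degree_power_eq mult.commute)
qed

text \<open>The main tool for excluding triples. As x^a (x^b - 1) is separable, the i-th row,
  counted from 1, has a nonzero entry. Its indices are ip - t with 1 <= t <= d, and one of them must
  be an exponent a e + b k.\<close>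

lemma two_term_window:
  assumes "a \<le> 1" "a + b = r" "b > 0" "\<not> p dvd b" "1 \<le> i" "i \<le> d"
  shows "\<exists>k\<le>e. \<exists>t. 1 \<le> t \<and> t \<le> d \<and> a * e + b * k + t = i * p"
proof -
  obtain v where v: "root_poly r v = (two_term a b :: 'p mod_ring alg_closure poly)"
    using two_term_root_poly[OF assms(3), of a] assms(2) by blast
  have "of_nat b \<noteq> (0 :: 'p mod_ring alg_closure)"
    using assms(4) by (simp add: of_nat_eq_0_iff_char_dvd p)
  then have "inj_on v {..<r}"
    using root_poly_two_term_distinct[OF assms(1,3)] v assms(2) by blast
  from det_distinct_nonzero[OF this]
  have "det (coeff_mat p (two_term a b ^ e :: 'p mod_ring alg_closure poly) d) \<noteq> 0" unfolding v .
  moreover have "i - 1 < d" using assms by linarith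
  ultimately obtain j where j: "j < d"
    "coeff_mat p (two_term a b ^ e :: 'p mod_ring alg_closure poly) d $$ (i - 1, j) \<noteq> 0"
    using exists_nonzero_in_row[OF coeff_mat_carrier] by blast
  moreover have ip: "p + (i - 1) * p = i * p" using assms(5) by (cases i) auto
  ultimately have "Polynomial.coeff (two_term a b ^ e :: 'p mod_ring alg_closure poly) (i * p + j - d) \<noteq> 0"
    using assms by simp
  then obtain k where k: "k \<le> e" "i * p + j - d = a * e + b * k"
    using coeff_two_term_power_nonzero_iff[OF p_prime CHAR_ac e_less assms(3), of a] by blast
  have "p \<le> i * p" using assms(5) by simp
  then have "a * e + b * k + (d - j) = i * p" using k(2) j(1) dp by linarith
  with k(1) j(1) show ?thesis by (intro exI[of _ k] conjI exI[of _ "d - j"]) auto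
qed

text \<open>The arithmetic conditions leave one case open; it is excluded by the inseparable quintic
  $x^2 (x-1)^2 (x-2)$, for which the determinant does not vanish.\<close>

lemma exceptional_case: "\<not> (p = 11 \<and> r = 5 \<and> d = 2 \<and> e = 5)"
proof
  assume *: "p = 11 \<and> r = 5 \<and> d = 2 \<and> e = 5"
  \<comment> \<open>The roots are 0, 0, 1, 1, 2. Taking them in the integers lets the determinant be
    computed there and reduced modulo 11 at the end.\<close>
  define w :: "nat \<Rightarrow> int" where "w = (\<lambda>k. if k < 2 then 0 else if k < 4 then 1 else 2)"
  let ?P = "root_poly 5 w"
  have hom: "comm_ring_hom (of_int :: int \<Rightarrow> 'p mod_ring)" by unfold_locales auto
  have "vandermonde_prod 5 (\<lambda>k. of_int (w k) :: 'p mod_ring) = 0"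
  proof -
    have "\<not> inj_on (\<lambda>k. of_int (w k) :: 'p mod_ring) {..<5}"
    proof
      assume "inj_on (\<lambda>k. of_int (w k) :: 'p mod_ring) {..<5}"
      from inj_onD[OF this, of 0 1] show False by (simp add: w_def)
    qed
    then show ?thesis using vandermonde_prod_nonzero_iff by blast
  qed
  moreover have "comm_ring_hom (\<lambda>x :: 'p mod_ring. x)" by unfold_locales auto
  ultimately have "det (coeff_mat 11 (root_poly 5 (\<lambda>k. of_int (w k) :: 'p mod_ring) ^ 5) 2) = 0"
    using det_eval[of "\<lambda>x. x" "\<lambda>k. of_int (w k)"] * g by auto
  then have 0: "of_int (det (coeff_mat 11 (?P ^ 5) 2)) = (0 :: 'p mod_ring)"
    by (simp only: comm_ring_hom.det_coeff_mat_hom[OF hom, symmetric] comm_ring_hom.map_root_poly[OF hom])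
  have "{..<5} = {0, 1, 2, 3, 4 :: nat}" by auto
  then have P: "?P = [:0, 0, - 2, 5, - 4, 1:]" by (simp add: root_poly_def w_def)
  have "x ^ 5 = x * ((x * x) * (x * x))" for x :: "int poly" by (simp add: eval_nat_numeral mult_ac)
  moreover have "?P * ?P = [:0, 0, 0, 0, 4, - 20, 41, - 44, 26, - 8, 1:]"
    unfolding P by simp
  moreover have "[:0, 0, 0, 0, 4, - 20, 41, - 44, 26, - 8, 1 :: int:] * [:0, 0, 0, 0, 4, - 20, 41, - 44, 26, - 8, 1:]
    = [:0, 0, 0, 0, 0, 0, 0, 0, 16, - 160, 728, - 1992, 3649, - 4712, 4396, - 2984, 1462, - 504, 116, - 16, 1:]" by simp
  ultimately have P5: "?P ^ 5 = [:0, 0, 0, 0, 0, 0, 0, 0, 0, 0, - 32, 400, - 2320, 8280, - 20330, 36365, - 48940, 50445, - 40140, 24650, - 11584, 4090, - 1050, 185, - 20, 1:]"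
    by (simp add: P)
  have "det (coeff_mat 11 F 2) = Polynomial.coeff F 9 * Polynomial.coeff F 21
      - Polynomial.coeff F 10 * Polynomial.coeff F 20" for F :: "int poly"
    by (subst det_2) simp_all
  \<comment> \<open>Coefficient 9 vanishes because x^10 divides the fifth power. What is left,
    -(-32)(-11584) = -370688, is 1 modulo 11.\<close>
  moreover have "Polynomial.coeff (?P ^ 5) 9 = 0" "Polynomial.coeff (?P ^ 5) 10 = - 32"
      "Polynomial.coeff (?P ^ 5) 20 = - 11584"
    unfolding P5 by (simp_all add: numeral_eq_Suc)
  ultimately have "det (coeff_mat 11 (?P ^ 5) 2) = - 370688" by simp
  with 0 have "of_int (- 370688) = (0 :: 'p mod_ring)" by (simp only:)
  then have "int p dvd - 370688" unfolding of_int_eq_0_iff_char_dvd by (simp add: p)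
  then show False using * by simp
qed

end

section \<open>Membership in A(p): reformulation and a sufficient criterion\<close>

lemma mem_setA_iff:
  "(int r, int e, int d) \<in> setA TYPE('p::prime_card) \<longleftrightarrow>
    (\<exists>\<epsilon> g. vandermonde_power_det CARD('p) r e d g (\<epsilon> :: 'p mod_ring))"
  unfolding setA_def vandermonde_power_det_def
  by (simp add: Mmat_eq_coeff_mat vdelta_eq conj_ac cong: conj_cong) blast

text \<open>\<open>up\<close> is what divisibility by the power 2e - p + 1 requires,
  \<open>deg\<close> says that this power has the degree of the determinant, and \<open>nz\<close>
  shows nonvanishing at one specialization.\<close>

lemma mem_setA_two_term:
  fixes r e d g :: nat
  defines "p \<equiv> CARD('p::prime_card)"
  assumes r: "2 \<le> r" and e: "e < p" "p \<le> 2 * e" and d: "1 \<le> d" "d \<le> p" and odd: "odd p"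
    and up: "r * e \<le> (d + 1) * (p - 1)"
    and deg: "p * d * (d + 1) + d * (d - 1) + (2 * e + 1 - p) * (r * (r - 1)) = 2 * d * (r * e + d)"
    and ab: "a + b = r" "b > 0"
    and nz: "det (coeff_mat p (two_term a b ^ e :: 'p mod_ring alg_closure poly) d) \<noteq> 0"
  shows "(int r, int e, int d) \<in> setA TYPE('p)"
proof -
  let ?D = "det (coeff_mat p (root_poly r (mVar :: nat \<Rightarrow> 'p mod_ring mpoly) ^ e) d)"
  have "prime p" unfolding p_def by (rule prime_card)
  have "of_nat n = mConst (of_nat n :: 'p mod_ring)" for n
    by (induction n) (simp_all add: mConst_def single_add)
  from this[of p] have char: "of_nat p = (0 :: 'p mod_ring mpoly)" by (simp add: mConst_def p_def)
  have dvd: "vandermonde_prod r mVar ^ (2 * e + 1 - p) dvd ?D"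
    using e(1)
    by (intro vandermonde_prod_power_dvd power_dvd_det_root_poly[OF \<open>prime p\<close> char odd _ d up]) simp_all
  have D: "?D \<noteq> 0"
  proof
    assume "?D = 0"
    moreover obtain v where v: "root_poly r v = (two_term a b :: 'p mod_ring alg_closure poly)"
      using two_term_root_poly[OF ab(2), of a] ab(1) by blast
    interpret E: comm_ring_hom "eval_mpoly to_ac v :: 'p mod_ring mpoly \<Rightarrow> _"
      by (rule eval_mpoly_hom[OF comm_ring_hom_to_ac])
    have "det (coeff_mat p (root_poly r v ^ e) d) = eval_mpoly to_ac v ?D"
      by (rule eval_det[OF comm_ring_hom_to_ac, symmetric])
    ultimately show False using nz v by simp
  qed
  have "2 * e + 1 - p > 0" using e by simp
  from det_eq_const_mult_vandermonde_prod[OF d(2) D this dvd deg] obtain c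
    where c: "c \<noteq> 0" "?D = mConst c * vandermonde_prod r mVar ^ (2 * e + 1 - p)" by blast
  have "vandermonde_power_det p r e d (2 * e + 1 - p) c"
    by unfold_locales (use r e d c in \<open>simp_all add: p_def\<close>)
  then show ?thesis unfolding mem_setA_iff p_def by blast
qed

text \<open>With $a = p \bmod r \ge 2$, one of the residues $y = d-a+1$, $d-a+2$ is the image of some
  $x < d$, and then $y + a$, the image of $x + 1$, has left the interval $[1, d]$.\<close>

lemma mod_eq_1_of_interval_invariant:
  fixes p r d :: nat
  assumes cop: "coprime p r" and d: "1 \<le> d" "d + 2 \<le> r"
    and inv: "\<And>x. 1 \<le> x \<Longrightarrow> x \<le> d \<Longrightarrow> 1 \<le> x * p mod r \<and> x * p mod r \<le> d"
  shows "p mod r = 1"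
proof (rule ccontr)
  assume "p mod r \<noteq> 1"
  let ?f = "\<lambda>x. x * p mod r" and ?a = "p mod r"
  have a: "2 \<le> ?a" "?a \<le> d" using inv[of 1] d \<open>p mod r \<noteq> 1\<close> by auto
  have "inj_on ?f {1..d}"
  proof (rule inj_onI)
    fix x y assume xy: "x \<in> {1..d}" "y \<in> {1..d}" "?f x = ?f y"
    then have "[x = y] (mod r)" using cop by (simp add: cong_def[symmetric] cong_mult_rcancel_nat)
    then show "x = y" using xy d by (auto simp: cong_def)
  qed
  then have surj: "?f ` {1..d} = {1..d}" using inv by (intro endo_inj_surj) auto
  \<comment> \<open>Of the two candidates at least one differs from the image of d, so its preimage
    x satisfies x + 1 <= d. Both are at most d because a >= 2.\<close>
  define y where "y = (if d - ?a + 1 = ?f d then d - ?a + 2 else d - ?a + 1)"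
  have y: "y \<noteq> ?f d" "1 \<le> y" "y \<le> d" "d < y + ?a" "y + ?a \<le> r"
    using a d by (auto simp: y_def)
  from y(2,3) have "y \<in> ?f ` {1..d}" unfolding surj by simp
  then obtain x where x: "x \<in> {1..d}" "y = ?f x" by blast
  then have "x + 1 \<le> d" using y(1) by (cases "x = d") auto
  moreover have "?f (x + 1) = (y + ?a) mod r"
    unfolding x(2) mod_add_eq by (simp add: add.commute)
  ultimately have "1 \<le> (y + ?a) mod r" "(y + ?a) mod r \<le> d" using inv[of "x + 1"] by auto
  \<comment> \<open>y + a is d + 1 or d + 2, hence at most r: its residue is itself, above d, or 0
    if it equals r.\<close>
  then show False using y by (cases "y + ?a = r") auto
qed

section \<open>Arithmetic constraints, by the size of d relative to r\<close>

context vandermonde_power_det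
begin

text \<open>Inserting g(r-1) <= ed into the degree equation and cancelling d gives 2(re + d) <=
  p(d+1) + d - 1 + re.\<close>

lemma degree_upper_bound: "r * e \<le> (d + 1) * (p - 1)"
proof -
  have "g * (r * (r - 1)) \<le> r * (e * d)"
    using mult_le_mono2[OF degree_first_variable, of r] by (simp add: mult_ac)
  moreover have "d * (2 * (r * e + d)) = p * d * (d + 1) + d * (d - 1) + g * (r * (r - 1))"
    using degree_equation by (simp add: mult_ac)
  moreover have "d * (p * (d + 1) + (d - 1) + r * e) = p * d * (d + 1) + d * (d - 1) + r * (e * d)"
    by (simp only: distrib_left mult_ac)
  ultimately have "d * (2 * (r * e + d)) \<le> d * (p * (d + 1) + (d - 1) + r * e)" by linarith
  then have le: "2 * (r * e + d) \<le> p * (d + 1) + (d - 1) + r * e" using d1 by simp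
  obtain s where "p = Suc s" using gr0_implies_Suc[OF prime_gt_0_nat[OF p_prime]] by blast
  moreover obtain c where "d = Suc c" using d1 by (cases d) auto
  ultimately show ?thesis using le by (simp add: algebra_simps)
qed

lemma d_le_r: "d \<le> r"
proof -
  have "d * (p - 1) \<le> r * (p - 1)"
    using degree_lower_bound mult_le_mono2[of e "p - 1" r] e_less by linarith
  then show ?thesis using prime_gt_1_nat[OF p_prime] by simp
qed

lemma d_eq_r: assumes "d = r" shows "e = p - 1"
  using degree_lower_bound assms e_less r2 by simp

text \<open>The first part is the degree equation after cancelling d and r; with g > 0 it yields p
  <= 2e. The second is the lower bound (r-1)(p-1) <= re rearranged.\<close>

lemma d_eq_pred_r:
  assumes "r = d + 1"
  shows "p + g = 2 * e + 1" "r * (p - 1 - e) \<le> p - 1"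
proof -
  have "d * (p * r + (d - 1) + g * r) = d * (2 * (r * e + d))"
    using degree_equation by (simp add: assms algebra_simps)
  then have "p * r + (d - 1) + g * r = 2 * (r * e + d)" using d1 by simp
  then have "r * (p + g) = r * (2 * e + 1)" using d1 by (simp add: assms algebra_simps)
  then have "p + g = 2 * e + 1 \<or> r = 0" by (simp only: mult_cancel1)
  then show "p + g = 2 * e + 1" using r2 by simp
  show "r * (p - 1 - e) \<le> p - 1"
    using degree_lower_bound by (simp add: assms diff_mult_distrib2)
qed

text \<open>If p divides r, the degree equation modulo p gives p | d(d+1), so d >= p - 1 and
  therefore r >= 2p. Then x^r - x is separable but too sparse for the second row.\<close>

lemma prime_not_dvd_r:
  assumes "d + 2 \<le> r" "p > 2"
  shows "\<not> p dvd r"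
proof
  assume dvd: "p dvd r"
  have "p * d * (d + 1) + g * (r * (r - 1)) = 2 * d * r * e + d * (d + 1)"
    using degree_equation d1 by (cases d) (auto simp: algebra_simps)
  moreover have "p dvd p * d * (d + 1) + g * (r * (r - 1))" "p dvd 2 * d * r * e"
    using dvd by simp_all
  ultimately have "p dvd d * (d + 1)" by (metis dvd_add_right_iff)
  then have "p dvd d \<or> p dvd d + 1" using p_prime by (simp only: prime_dvd_mult_iff)
  then have "p \<le> d + 1" using d1 by (auto dest: dvd_imp_le)
  moreover obtain l where l: "r = p * l" using dvd by (elim dvdE)
  ultimately have "l \<ge> 2" using assms by (cases l; cases "l - 1") auto
  then have "2 * p \<le> r" unfolding l by simp
  moreover have "\<not> p dvd r - 1"
  proof
    assume "p dvd r - 1"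
    with dvd have "p dvd r - (r - 1)" by (rule dvd_diff_nat)
    then show False using assms(2) r2 by simp
  qed
  \<comment> \<open>No k fits: for k = 0 the sum is at most e + d < 2p, and for k >= 1 it exceeds 2p
    because r - 1 >= 2p - 1.\<close>
  then obtain k t where "1 \<le> t" "t \<le> d" "e + (r - 1) * k + t = 2 * p"
    using two_term_window[of 1 "r - 1" 2] r2 assms \<open>p \<le> d + 1\<close> by auto
  ultimately show False using e_less e1 dp r2 by (cases k) auto
qed

lemma r_dvd_pred_p:
  assumes "d + 2 \<le> r" "p > 2"
  shows "r dvd p - 1"
proof -
  have "coprime p r"
    using p_prime prime_not_dvd_r[OF assms] by (rule prime_imp_coprime)
  moreover have "1 \<le> x * p mod r \<and> x * p mod r \<le> d" if "1 \<le> x" "x \<le> d" for x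
  proof -
    have "\<exists>k\<le>e. \<exists>t. 1 \<le> t \<and> t \<le> d \<and> 0 * e + r * k + t = x * p"
      by (rule two_term_window) (use prime_not_dvd_r[OF assms] that r2 in auto)
    then obtain k t where t: "1 \<le> t" "t \<le> d" "r * k + t = x * p" by auto
    then have "x * p mod r = t" unfolding t(3)[symmetric] using assms(1) by simp
    with t show ?thesis by simp
  qed
  ultimately have "p mod r = 1" using d1 assms(1) by (intro mod_eq_1_of_interval_invariant)
  then show ?thesis by (metis dvd_minus_mod)
qed

lemma case_r_eq_pred_p:
  assumes r: "r = p - 1" and d: "d + 2 \<le> r" and odd: "odd p"
  shows "d + 2 = r \<and> e = p - 2"
proof -
  have p5: "p \<ge> 4" using r d d1 by linarith
  have "d \<le> e" using degree_lower_bound r2 unfolding r by simp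
  moreover have "(p - 1) * e \<le> (p - 1) * (d + 1)"
    using degree_upper_bound by (simp only: r mult.commute)
  then have "e \<le> d + 1" using p5 by (simp only: mult_le_cancel1)
  ultimately consider "e = d" | "e = d + 1" by linarith
  moreover have win: "\<exists>k t. 1 \<le> t \<and> t \<le> d \<and> e + (p - 2) * k + t = i * p" if "1 \<le> i" "i \<le> d" for i
  proof -
    have "\<not> p dvd p - 2" using p5 by (auto dest: dvd_imp_le)
    then have "\<exists>k\<le>e. \<exists>t. 1 \<le> t \<and> t \<le> d \<and> 1 * e + (p - 2) * k + t = i * p"
      by (intro two_term_window) (use that r p5 in auto)
    then show ?thesis by auto
  qed
  \<comment> \<open>Here ip = (p-2)i + 2i. From 2i <= e follows k < i, so e + t, which is at most e
    + d, exceeds 2i by at least p - 2.\<close>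
  have step: "e + d + 2 \<ge> p + 2 * i" if i: "1 \<le> i" "i \<le> d" "2 * i \<le> e" for i
  proof -
    obtain k t where kt: "1 \<le> t" "t \<le> d" "e + (p - 2) * k + t = i * p" using win i by blast
    have ip: "i * p = (p - 2) * i + 2 * i" using p5 by (simp add: diff_mult_distrib algebra_simps)
    have "k < i"
    proof (rule ccontr)
      assume "\<not> k < i"
      then have "(p - 2) * i \<le> (p - 2) * k" by (intro mult_le_mono2) simp
      then show False using kt ip i by linarith
    qed
    then have "(p - 2) * k + (p - 2) \<le> (p - 2) * i"
      using mult_le_mono2[of "Suc k" i "p - 2"] by simp
    then show ?thesis using kt ip p5 by linarith
  qed
  ultimately show ?thesis
  proof cases
    case 1
    have "d * (d + 1) * (r + 1) + d * (d - 1) + g * (r * (r - 1)) = 2 * d * (r * d + d)"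
      using degree_equation 1 r r2 by (simp add: algebra_simps)
    then have "d \<noteq> 1" using g r2 by auto
    \<comment> \<open>The strongest choice is i = e div 2. For even d the bound reads d + 2 >= p,
      for odd d it reads d + 3 >= p; the latter forces d = p - 3, which is even.\<close>
    then have "e + d + 2 \<ge> p + 2 * (d div 2)" using d1 1 by (intro step) auto
    then have False using 1 d r odd d1 by presburger
    then show ?thesis ..
  next
    case 2
    have "e + d + 2 \<ge> p + 2 * ((d + 1) div 2)" using d1 2 by (intro step) auto
    then show ?thesis using 2 d r d1 by presburger
  qed
qed

lemma case_r_eq_half_pred_p:
  assumes p2: "p = 2 * r + 1" and d: "d + 2 \<le> r" and prime_r: "prime r"
  shows "d + 2 = r \<and> e = 2 * r - 2"
proof -
  have low: "2 * d \<le> e" using degree_lower_bound r2 unfolding p2 by simp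
  have "r * e \<le> r * (2 * d + 2)" using degree_upper_bound unfolding p2 by (simp add: algebra_simps)
  then have up: "e \<le> 2 * d + 2" using r2 by (simp only: mult_le_cancel1)
  have "r * (2 * d * (d + 1) + g * (r - 1)) = r * (2 * d * e)"
    using degree_equation d1 unfolding p2 by (cases d) (auto simp: algebra_simps)
  then have deg: "2 * d * (d + 1) + g * (r - 1) = 2 * d * e" using r2 by simp
  moreover have "0 < g * (r - 1)" using g r2 by simp
  ultimately have "2 * d * (d + 1) < 2 * d * e" by linarith
  then have "d + 1 < e" by (simp only: mult_less_cancel1)
  then have e_lower: "d + 2 \<le> e" by simp
  define R where "R = r - 1"
  \<comment> \<open>Since p = 2R + 3, the target ip is 2iR + 3i. This i is the largest with 3i <= e,
    which keeps k below 2i and gives the strongest bound on r.\<close>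
  define i where "i = e div 3"
  have e_i: "e = 3 * i + e mod 3" by (simp add: i_def)
  have rR: "r = R + 1" using r2 by (simp add: R_def)
  have i: "1 \<le> i" "i \<le> d" using e_lower d1 up by (auto simp: i_def)
  have "\<not> p dvd R" using p2 r2 by (auto simp: R_def dest: dvd_imp_le)
  then obtain k t where kt: "1 \<le> t" "t \<le> d" "e + R * k + t = i * p"
    using two_term_window[of 1 R i] i r2 by (auto simp: R_def)
  have ip: "i * p = R * (2 * i) + 3 * i"
    unfolding p2 rR by (simp add: algebra_simps)
  have "k < 2 * i"
  proof (rule ccontr)
    assume "\<not> k < 2 * i"
    then have "R * (2 * i) \<le> R * k" by (intro mult_le_mono2) simp
    then show False using kt ip e_i by linarith
  qed
  then have "R * k + R \<le> R * (2 * i)"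
    using mult_le_mono2[of "Suc k" "2 * i" R] by simp
  then have "R + 3 * i \<le> e + t" using kt ip by linarith
  then have window: "r \<le> e mod 3 + d + 1" using kt(2) rR e_i by linarith
  then consider "r = d + 2" | "r = d + 3" "e mod 3 = 2" using d by (auto, linarith)
  then show ?thesis
  proof cases
    case 1
    then have g_eq: "2 * d * (d + 1) + g * (d + 1) = 2 * d * e" using deg by simp
    from low up consider "e = 2 * d" | "e = 2 * d + 1" | "e = 2 * d + 2" by linarith
    then show ?thesis
    proof cases
      assume e: "e = 2 * d"
      \<comment> \<open>Reducing modulo d + 1, where d is -1, leaves d + 1 | 4. Then d = 1 would
        give g = 0, and d = 3 violates \<open>window\<close>.\<close>
      have "4 * (d * d) = (d + 1) * (2 * d + g)" using g_eq e by (simp add: algebra_simps)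
      moreover have "4 * (d * d) + 4 * (d + 1) = (d + 1) * (4 * d) + 4" by (simp add: algebra_simps)
      ultimately have "(d + 1) * (2 * d + g) + 4 * (d + 1) = (d + 1) * (4 * d) + 4" by simp
      then have "d + 1 dvd (d + 1) * (4 * d) + 4" by (metis dvd_add dvd_triv_left dvd_triv_right)
      then have "d + 1 dvd 4" by (simp only: dvd_add_right_iff dvd_triv_left)
      then have "d + 1 \<le> 4" by (rule dvd_imp_le) simp
      then consider "d = 1" | "d = 2" | "d = 3" using d1 by linarith
      then show ?thesis using \<open>d + 1 dvd 4\<close> g_eq g e window 1 by cases auto
    next
      assume e: "e = 2 * d + 1"
      have "(d + 1) * (2 * d + g) + 2 * (d + 1) = (d + 1) * (4 * d) + 2"
        using g_eq e by (simp add: algebra_simps)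
      then have "d + 1 dvd (d + 1) * (4 * d) + 2" by (metis dvd_add dvd_triv_left dvd_triv_right)
      then have "d + 1 dvd 2" by (simp only: dvd_add_right_iff dvd_triv_left)
      then have "d + 1 \<le> 2" by (rule dvd_imp_le) simp
      then have "d = 1" using d1 by linarith
      then show ?thesis using e window 1 by simp
    qed (use 1 in simp)
  next
    case 2
    then have g_eq: "2 * d * (d + 1) + g * (d + 2) = 2 * d * e" using deg by simp
    \<comment> \<open>Modulo d + 2, where d is -2, 2d(d+1) is 4 and 2de is -4e. For e = 2d, 2d + 1,
      2d + 2 this makes d + 2 divide 12, 8, 4.\<close>
    have dvd: "d + 2 dvd 4 * (e + 1)"
    proof -
      have "4 * (e + 1) + (d + 2) * (2 * d + g) = (d + 2) * (2 * e + 2)"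
        using g_eq by (simp add: algebra_simps)
      then show ?thesis by (metis dvd_add_left_iff dvd_triv_left)
    qed
    from low up consider "e = 2 * d" | "e = 2 * d + 1" | "e = 2 * d + 2" by linarith
    then have False
    proof cases
      assume e: "e = 2 * d"
      then have "4 * (e + 1) + 12 = (d + 2) * 8" by simp
      then have "d + 2 dvd 12" using dvd by (metis dvd_add_right_iff dvd_triv_left)
      then have "d + 2 \<le> 12" by (rule dvd_imp_le) simp
      then have "d = 1 \<or> d = 2 \<or> d = 3 \<or> d = 4 \<or> d = 5 \<or> d = 6 \<or> d = 7 \<or> d = 8 \<or> d = 9 \<or> d = 10"
        using d1 by presburger
      \<comment> \<open>The condition e mod 3 = 2 leaves d = 1, 4, 10, where r = 4, p = 15 and p =
        27 are not prime.\<close>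
      then show False using \<open>d + 2 dvd 12\<close> e 2 p2 p_prime prime_r by (elim disjE) simp_all
    next
      assume e: "e = 2 * d + 1"
      then have "4 * (e + 1) + 8 = (d + 2) * 8" by simp
      then have "d + 2 dvd 8" using dvd by (metis dvd_add_right_iff dvd_triv_left)
      then have "d + 2 \<le> 8" by (rule dvd_imp_le) simp
      then have "d = 1 \<or> d = 2 \<or> d = 3 \<or> d = 4 \<or> d = 5 \<or> d = 6" using d1 by presburger
      \<comment> \<open>d = 2 is the exceptional triple (5, 5, 2) with p = 11, and d = 6 contradicts
        e mod 3 = 2.\<close>
      then show False
        using \<open>d + 2 dvd 8\<close> e 2 p2 prime_r exceptional_case by (elim disjE) simp_all
    next
      assume e: "e = 2 * d + 2"
      then have "4 * (e + 1) + 4 = (d + 2) * 8" by simp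
      then have "d + 2 dvd 4" using dvd by (metis dvd_add_right_iff dvd_triv_left)
      then have "d + 2 \<le> 4" by (rule dvd_imp_le) simp
      then have "d \<in> {1, 2}" using d1 by auto
      then show False using \<open>d + 2 dvd 4\<close> e 2 by auto
    qed
    then show ?thesis ..
  qed
qed

lemma admissible:
  assumes q: "prime q" and p_eq: "p = 2 * q + 1"
  shows "r \<le> p \<and> e = p - 1 \<and> d = r
    \<or> r \<le> p + 1 \<and> p \<le> 2 * e \<and> r * (p - 1 - e) \<le> p - 1 \<and> r = d + 1
    \<or> p \<le> 2 * e \<and> r * (p - 1 - e) = p - 1 \<and> r = d + 2"
proof -
  have p5: "p \<ge> 5" using prime_ge_2_nat[OF q] p_eq by simp
  consider "d = r" | "r = d + 1" | "d + 2 \<le> r" using d_le_r by linarith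
  then show ?thesis
  proof cases
    case 1
    then show ?thesis using d_eq_r dp by simp
  next
    case 2
    then show ?thesis using d_eq_pred_r[OF 2] g dp by simp
  next
    case 3
    have "r dvd 2 * q" using r_dvd_pred_p[OF 3] p5 by (simp add: p_eq)
    \<comment> \<open>A divisor of 2q prime to q is at most 2, whereas r >= d + 2 >= 3.\<close>
    moreover have "r = q \<or> r = 2 * q"
    proof (cases "q dvd r")
      case True
      then obtain s where s: "r = q * s" by (elim dvdE)
      then have "q * s dvd q * 2" using \<open>r dvd 2 * q\<close> by (simp add: mult.commute)
      then have "s dvd 2" using q by (simp add: prime_gt_0_nat)
      then have "s = 1 \<or> s = 2" using two_is_prime_nat prime_nat_iff by blast
      then show ?thesis using s by auto
    next
      case False
      then have "coprime q r" using q by (simp add: prime_imp_coprime)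
      then have "r dvd 2" using calculation by (simp add: coprime_dvd_mult_left_iff coprime_commute)
      then have "r \<le> 2" by (rule dvd_imp_le) simp
      then show ?thesis using 3 d1 by simp
    qed
    ultimately consider "r = q" | "r = 2 * q" by blast
    then show ?thesis
    proof cases
      assume r: "r = q"
      then have de: "d + 2 = r \<and> e = 2 * r - 2" using 3 p_eq q by (intro case_r_eq_half_pred_p) simp_all
      moreover from this have "p - 1 - e = 2" using p_eq r r2 by simp
      moreover have "p \<le> 2 * e" using de p_eq r d1 by arith
      ultimately show ?thesis using p_eq r 3 d1 by simp
    next
      assume r: "r = 2 * q"
      then have "d + 2 = r \<and> e = p - 2" using 3 p_eq by (intro case_r_eq_pred_p) simp_all
      moreover from this have "p - 1 - e = 1" using p5 by simp
      ultimately show ?thesis using p_eq r p5 by simp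
    qed
  qed
qed

end

lemma setA_subset_setB:
  assumes q: "prime q" and card: "CARD('p::prime_card) = 2 * q + 1"
  shows "setA TYPE('p) \<subseteq> setB (int CARD('p))"
proof
  fix x assume x: "x \<in> setA TYPE('p)"
  obtain r' e' d' where "x = (r', e', d')" by (cases x)
  then obtain r e d :: nat where x_eq: "x = (int r, int e, int d)"
    using x by (auto simp: setA_def intro!: that[of "nat r'" "nat e'" "nat d'"])
  then obtain \<epsilon> g where "vandermonde_power_det CARD('p) r e d g (\<epsilon> :: 'p mod_ring)"
    using x mem_setA_iff by blast
  then interpret vandermonde_power_det "CARD('p)" r e d g \<epsilon> .
  have int_e: "int (CARD('p) - 1 - e) = int CARD('p) - 1 - int e"
    using e_less by simp
  have int_p: "int (CARD('p) - 1) = int CARD('p) - 1" using e_less by simp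
  from admissible[OF q card] consider
      "r \<le> CARD('p)" "e = CARD('p) - 1" "d = r"
    | "r \<le> CARD('p) + 1" "CARD('p) \<le> 2 * e" "r * (CARD('p) - 1 - e) \<le> CARD('p) - 1" "r = d + 1"
    | "CARD('p) \<le> 2 * e" "r * (CARD('p) - 1 - e) = CARD('p) - 1" "r = d + 2"
    by blast
  then show "x \<in> setB (int CARD('p))"
  proof cases
    case 1
    then have "x \<in> setB_plus (int CARD('p))" using r2 e_less by (auto simp: setB_plus_def x_eq)
    then show ?thesis by (simp add: setB_def)
  next
    case 2
    then have "int r * (int CARD('p) - 1 - int e) \<le> int CARD('p) - 1"
      by (metis int_e int_p of_nat_le_iff of_nat_mult)
    then have "x \<in> setB_zero (int CARD('p))" using 2 r2 e_less by (auto simp: setB_zero_def x_eq)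
    then show ?thesis by (simp add: setB_def)
  next
    case 3
    then have "int r * (int CARD('p) - 1 - int e) = int CARD('p) - 1"
      by (metis int_e int_p of_nat_mult)
    then have "x \<in> setB_minus (int CARD('p))" using 3 r2 e_less by (auto simp: setB_minus_def x_eq)
    then show ?thesis by (simp add: setB_def)
  qed
qed

section \<open>The triples of $\mathscr{B}(p)$\<close>

lemma mem_setA_coprime:
  fixes r e d :: nat
  defines "p \<equiv> CARD('p::prime_card)"
  assumes r: "2 \<le> r" and e: "e < p" "p \<le> 2 * e" and d: "1 \<le> d" "d \<le> p" "d \<le> r" and odd: "odd p"
    and low: "d * (p - 1) \<le> r * e" and up: "r * e \<le> (d + 1) * (p - 1)"
    and deg: "p * d * (d + 1) + d * (d - 1) + (2 * e + 1 - p) * (r * (r - 1)) = 2 * d * (r * e + d)"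
    and cop: "coprime p r"
    and t: "\<And>i. i < d \<Longrightarrow> \<exists>t. 1 \<le> t \<and> t \<le> d \<and> [(i + 1) * p = t] (mod r)"
  shows "(int r, int e, int d) \<in> setA TYPE('p)"
proof (rule mem_setA_two_term)
  have "prime p" unfolding p_def by (rule prime_card)
  then show "det (coeff_mat CARD('p) (two_term 0 r ^ e :: 'p mod_ring alg_closure poly) d) \<noteq> 0"
    unfolding p_def[symmetric]
    by (rule det_two_term_0_nonzero) (use assms in \<open>simp_all add: p_def\<close>)
qed (use assms in \<open>simp_all add: p_def\<close>)

text \<open>The triples with p | r: d = p occurs in B_+ and d = p - 1 in B_0.\<close>

lemma mem_setA_r_eq_p:
  fixes d :: nat
  defines "p \<equiv> CARD('p::prime_card)"
  assumes d: "d = p \<or> d = p - 1" and odd: "odd p"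
  shows "(int p, int (p - 1), int d) \<in> setA TYPE('p)"
proof -
  have p: "prime p" unfolding p_def by (rule prime_card)
  then have p2: "p \<ge> 2" by (rule prime_ge_2_nat)
  then have d': "1 \<le> d" "d \<le> p" "p \<le> d + 1" using d by linarith+
  obtain m where m: "p = Suc (Suc m)" using le_Suc_ex[OF p2] by auto
  show ?thesis
  proof (rule mem_setA_two_term, fold p_def)
    show "det (coeff_mat p (two_term 1 (p - 1) ^ (p - 1) :: 'p mod_ring alg_closure poly) d) \<noteq> 0"
      by (rule det_two_term_1_nonzero[OF p]) (use d' in \<open>simp_all add: p_def\<close>)
    have g: "2 * (p - 1) + 1 - p = Suc m" by (simp add: m)
    have "d = Suc m \<or> d = Suc (Suc m)" using d by (auto simp: m)
    then show "p * d * (d + 1) + d * (d - 1) + (2 * (p - 1) + 1 - p) * (p * (p - 1))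
        = 2 * d * (p * (p - 1) + d)"
      unfolding g by (elim disjE) (simp_all add: m algebra_simps)
    show "p * (p - 1) \<le> (d + 1) * (p - 1)" using d'(3) by (rule mult_le_mono1)
    show "p - 1 < p" "p \<le> 2 * (p - 1)" "1 + (p - 1) = p" "0 < p - 1" using p2 by linarith+
  qed (fact p2 d' odd)+
qed

lemma setB_plus_subset_setA:
  assumes odd: "odd CARD('p::prime_card)"
  shows "setB_plus (int CARD('p)) \<subseteq> setA TYPE('p)"
proof
  define p where "p = CARD('p)"
  have p: "prime p" unfolding p_def by (rule prime_card)
  fix x assume "x \<in> setB_plus (int CARD('p))"
  then obtain r' where r': "x = (r', int p - 1, r')" "2 \<le> r'" "r' \<le> int p"
    by (auto simp: setB_plus_def p_def)
  define r where "r = nat r'"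
  have x: "x = (int r, int (p - 1), int r)" and r: "2 \<le> r" "r \<le> p"
    using r' by (auto simp: r_def)
  show "x \<in> setA TYPE('p)"
  proof (cases "r = p")
    case True
    then show ?thesis using mem_setA_r_eq_p[of p, where 'p='p] odd by (simp add: x p_def)
  next
    case False
    then have cop: "coprime p r"
      using p r by (intro prime_imp_coprime) (auto dest: dvd_imp_le)
    obtain m where m: "p = Suc (Suc m)" using le_Suc_ex[OF le_trans[OF r]] by auto
    obtain l where l: "r = Suc l" using r by (cases r) auto
    show ?thesis unfolding x
    proof (rule mem_setA_coprime)
      fix i assume "i < r"
      \<comment> \<open>As d = r, every residue is allowed; the shift by one represents the residue
        0 by r.\<close>
      let ?t = "((i + 1) * p - 1) mod r + 1"
      have "(i + 1) * p - 1 + 1 = (i + 1) * p" using r by simp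
      moreover have "[(i + 1) * p - 1 + 1 = ?t] (mod r)"
        unfolding cong_add_rcancel_nat by (simp add: cong_def)
      ultimately have "[(i + 1) * CARD('p) = ?t] (mod r)" by (simp only: p_def)
      moreover have "?t \<le> r" using r by (simp add: Suc_leI)
      ultimately show "\<exists>t. 1 \<le> t \<and> t \<le> r \<and> [(i + 1) * CARD('p) = t] (mod r)"
        by (intro exI[of _ ?t]) simp
    qed (use r cop odd in \<open>auto simp: p_def[symmetric] m l algebra_simps\<close>)
  qed
qed

lemma setB_zero_subset_setA:
  assumes odd: "odd CARD('p::prime_card)"
  shows "setB_zero (int CARD('p)) \<subseteq> setA TYPE('p)"
proof
  define p where "p = CARD('p)"
  have p: "prime p" unfolding p_def by (rule prime_card)
  fix x assume "x \<in> setB_zero (int CARD('p))"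
  then obtain r' e' where x': "x = (r', e', r' - 1)" "2 \<le> r'" "r' \<le> int p + 1" "int p - 1 < 2 * e'"
      "e' \<le> int p - 1" "r' * (int p - 1 - e') \<le> int p - 1"
    by (auto simp: setB_zero_def p_def)
  define d where "d = nat (r' - 1)"
  define e where "e = nat e'"
  define m where "m = nat (int p - 1 - e')"
  have x: "x = (int (d + 1), int e, int d)" and d: "1 \<le> d" "d \<le> p" and e: "p \<le> 2 * e" "p = e + m + 1"
    using x' by (auto simp: d_def e_def m_def)
  have ints: "int (d + 1) = r'" "int m = int p - 1 - e'" "int (e + m) = int p - 1"
    using x' by (simp_all add: d_def e_def m_def)
  have "int ((d + 1) * m) \<le> int (e + m)"
    unfolding of_nat_mult ints by (fact x'(6))
  then have m: "(d + 1) * m \<le> e + m" by (simp only: of_nat_le_iff)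
  obtain c where c: "d = Suc c" using d by (cases d) auto
  show "x \<in> setA TYPE('p)"
  proof (cases "p = d + 1")
    case True
    then have "m = 0" using m e by (cases m) auto
    then show ?thesis using mem_setA_r_eq_p[of d, where 'p='p] odd True e
      by (simp add: x p_def[symmetric])
  next
    case False
    have cop: "coprime p (d + 1)"
    proof (rule prime_imp_coprime[OF p])
      show "\<not> p dvd d + 1"
      proof
        assume "p dvd d + 1"
        then obtain k where k: "d + 1 = p * k" by (elim dvdE)
        \<comment> \<open>r <= p + 1 < 2p, so p could divide r only for r = p.\<close>
        moreover have "d + 1 < p * 2" using d prime_gt_1_nat[OF p] by simp
        ultimately have "k < 2" by simp
        then show False using False k by (auto dest!: less_2_cases)
      qed
    qed
    obtain h where h: "2 * e = p + h" using e(1) le_Suc_ex by blast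
    show ?thesis unfolding x
    proof (rule mem_setA_coprime)
      fix i assume i: "i < d"
      \<comment> \<open>As d = r - 1, every nonzero residue is allowed, and r divides (i+1)p only if
        it divides i + 1 <= d.\<close>
      let ?t = "((i + 1) * p) mod (d + 1)"
      have "coprime (d + 1) p" using cop by (simp only: coprime_commute)
      then have "d + 1 dvd (i + 1) * p \<longleftrightarrow> d + 1 dvd i + 1" by (rule coprime_dvd_mult_left_iff)
      then have "\<not> d + 1 dvd (i + 1) * p" using i by (auto dest: dvd_imp_le)
      then have "1 \<le> ?t" by (simp add: dvd_eq_mod_eq_0 del: mult_Suc add_Suc_right)
      moreover have "?t \<le> d" using mod_less_divisor[of "d + 1" "(i + 1) * p"] by linarith
      ultimately show "\<exists>t. 1 \<le> t \<and> t \<le> d \<and> [(i + 1) * CARD('p) = t] (mod (d + 1))"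
        by (intro exI[of _ ?t]) (simp add: cong_def p_def)
    next
      show "CARD('p) * d * (d + 1) + d * (d - 1) + (2 * e + 1 - CARD('p)) * ((d + 1) * (d + 1 - 1))
          = 2 * d * ((d + 1) * e + d)"
      proof -
        have "2 * e + 1 - p = h + 1" using h by simp
        moreover have "2 * d * ((d + 1) * e + d) = d * ((d + 1) * (2 * e) + 2 * d)"
          by (simp add: algebra_simps)
        ultimately show ?thesis unfolding p_def[symmetric] h by (simp add: c algebra_simps)
      qed
    qed (use d e m cop odd in \<open>auto simp: p_def[symmetric] algebra_simps\<close>)
  qed
qed

lemma setB_minus_subset_setA:
  assumes odd: "odd CARD('p::prime_card)"
  shows "setB_minus (int CARD('p)) \<subseteq> setA TYPE('p)"
proof
  define p where "p = CARD('p)"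
  have p: "prime p" unfolding p_def by (rule prime_card)
  fix x assume "x \<in> setB_minus (int CARD('p))"
  then obtain r' e' where x': "x = (r', e', r' - 2)" "2 \<le> r'" "int p - 1 < 2 * e'"
      "e' \<le> int p - 1" "r' * (int p - 1 - e') = int p - 1"
    by (auto simp: setB_minus_def p_def)
  define d where "d = nat (r' - 2)"
  define e where "e = nat e'"
  define m where "m = nat (int p - 1 - e')"
  have x: "x = (int (d + 2), int e, int d)" and e: "p \<le> 2 * e" "p = e + m + 1"
    using x' by (auto simp: d_def e_def m_def)
  have ints: "int (d + 2) = r'" "int m = int p - 1 - e'" "int (e + m) = int p - 1"
    using x' by (simp_all add: d_def e_def m_def)
  have "int ((d + 2) * m) = int (e + m)"
    unfolding of_nat_mult ints by (fact x'(5))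
  then have em: "(d + 2) * m = e + m" by (simp only: of_nat_eq_iff)
  \<comment> \<open>d = 0 would give e = m and p = 2e + 1, against p <= 2e.\<close>
  have "d \<noteq> 0" using em e by auto
  then obtain c where c: "d = Suc c" by (cases d) auto
  have "m \<noteq> 0" using em e by (cases m) auto
  have e_eq: "e = (d + 1) * m" using em by simp
  have p_eq: "p = (d + 2) * m + 1" using em e by simp
  have dp: "d + 2 < p" using \<open>m \<noteq> 0\<close> p_eq by (cases m) auto
  have cop: "coprime p (d + 2)"
    using p dp by (intro prime_imp_coprime) (auto dest: dvd_imp_le)
  show "x \<in> setA TYPE('p)" unfolding x
  proof (rule mem_setA_coprime)
    fix i assume i: "i < d"
    \<comment> \<open>p is 1 modulo r, so each i + 1 is its own representative.\<close>
    have "(i + 1) * p = (d + 2) * ((i + 1) * m) + (i + 1)" unfolding p_eq by (simp add: algebra_simps)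
    then have "[(i + 1) * p = i + 1] (mod (d + 2))" by (simp only: cong_def mod_mult_self4)
    then show "\<exists>t. 1 \<le> t \<and> t \<le> d \<and> [(i + 1) * CARD('p) = t] (mod (d + 2))"
      using i by (intro exI[of _ "i + 1"]) (simp add: p_def)
  next
    have "2 * e + 1 - p = d * m" unfolding e_eq p_eq by (simp add: algebra_simps)
    then show "CARD('p) * d * (d + 1) + d * (d - 1) + (2 * e + 1 - CARD('p)) * ((d + 2) * (d + 2 - 1))
        = 2 * d * ((d + 2) * e + d)"
      unfolding p_def[symmetric] by (simp add: p_eq e_eq c algebra_simps)
  qed (use e dp cop odd \<open>d \<noteq> 0\<close> in \<open>auto simp: p_def[symmetric] e_eq p_eq algebra_simps\<close>)
qed

theorem theorem4:
  fixes q :: nat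
  assumes "prime q" and "CARD('p::prime_card) = 2 * q + 1"
  shows "setA TYPE('p) = setB (int CARD('p))"
proof
  have odd: "odd CARD('p)" using assms(2) by simp
  show "setA TYPE('p) \<subseteq> setB (int CARD('p))" using assms by (rule setA_subset_setB)
  show "setB (int CARD('p)) \<subseteq> setA TYPE('p)"
    unfolding setB_def
    using setB_plus_subset_setA[OF odd] setB_zero_subset_setA[OF odd] setB_minus_subset_setA[OF odd]
    by blast
qed

end
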